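(* Let $p$ be a prime number, $m$ a positive integer and $t$ a nonnegative integer. Let $C$ be a free simplicial $\mathbb Z_p$-complex such that $\mathrm{ind}_{\mathbb Z_p}(C)\geq t$ and let $\lambda:C\to(\sigma^{p-1}_{p-2})^{*m}$ be a simplicial $\mathbb Z_p$-map. Then there is at least one $t$-dimensional simplex $\sigma\in C$ such that $\tau=\lambda(\sigma)$ is a $t$-dimensional simplex and, for each $\epsilon\in\mathbb Z_p$, $$\left\lfloor\frac{t+1}{p}\right\rfloor\leq|\tau^\epsilon|\leq\left\lceil\frac{t+1}{p}\right\rceil.$$
   Context: $\mathbb Z_p$ is the cyclic group of order $p$. Simplicial complexes are finite. A simplicial $\mathbb Z_p$-complex is a simplicial complex with a $\mathbb Z_p$-action on its vertices by simplicial maps; it is free if no non-identity element fixes a simplex. A simplicial $\mathbb Z_p$-map is a simplicial map $f$ with $f(g\cdot v)=g\cdot f(v)$ for all $g\in\mathbb Z_p$ and vertices $v$. $E_n\mathbb Z_p$ denotes any free $(n-1)$-connected $n$-dimensional simplicial $\mathbb Z_p$-complex, e.g. the $(n+1)$-fold join $\mathbb Z_p^{*(n+1)}$. For a $\mathbb Z_p$-space $X$, $\mathrm{ind}_{\mathbb Z_p}(X)$ is the least $n$ such that there is a continuous $\mathbb Z_p$-equivariant map $X\to E_n\mathbb Z_p$ (independent of the choice of $E_n\mathbb Z_p$); for a simplicial complex $K$, $\mathrm{ind}_{\mathbb Z_p}(K)$ means $\mathrm{ind}_{\mathbb Z_p}(\|K\|)$, with $\|K\|$ the geometric realization. $\sigma^{p-1}_{p-2}$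 is the $(p-2)$-dimensional simplicial complex with vertex set $\mathbb Z_p$ whose maximal simplices are all $(p-1)$-subsets of $\mathbb Z_p$. $(\sigma^{p-1}_{p-2})^{*m}$ is its $m$-fold join, with vertex set $\mathbb Z_p\times[m]$ (so $\tau\subseteq\mathbb Z_p\times[m]$ is a simplex iff for each $j\in[m]$ not all of the $p$ vertices $(\epsilon,j)$, $\epsilon\in\mathbb Z_p$, belong to $\tau$); $\mathbb Z_p$ acts by $\epsilon\cdot(\epsilon',j)=(\epsilon\epsilon',j)$. For a simplex $\tau$ of it and $\epsilon\in\mathbb Z_p$, $\tau^\epsilon=\{(\epsilon,j):(\epsilon,j)\in\tau\}$. *)

theory Defs
  imports
    "HOL-Analysis.Analysis"
    "HOL-Algebra.Elementary_Groups"
    "HOL-Algebra.Group_Action"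
    "HOL-Computational_Algebra.Primes"
begin

section \<open>Finite abstract simplicial complexes\<close>

text \<open>
  A complex is given by its set of nonempty simplices. The complex may be empty.
\<close>

definition abstract_complex :: "'a set set \<Rightarrow> bool" where
  "abstract_complex K \<longleftrightarrow>
     finite K \<and>
     (\<forall>\<sigma>\<in>K. finite \<sigma> \<and> \<sigma> \<noteq> {}) \<and>
     (\<forall>\<sigma>\<in>K. \<forall>\<tau>. \<tau> \<noteq> {} \<and> \<tau> \<subseteq> \<sigma> \<longrightarrow> \<tau> \<in> K)"

definition vertex_set :: "'a set set \<Rightarrow> 'a set" where
  "vertex_set K = \<Union>K"

text \<open>Only meaningful for nonempty finite \<open>\<sigma>\<close>, respectively nonempty finite \<open>K\<close>.\<close>

definition simplex_dim :: "'a set \<Rightarrow> nat" where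
  "simplex_dim \<sigma> = card \<sigma> - 1"

definition complex_dim :: "'a set set \<Rightarrow> nat" where
  "complex_dim K = Max (simplex_dim ` K)"

definition simplicial_map :: "'a set set \<Rightarrow> 'b set set \<Rightarrow> ('a \<Rightarrow> 'b) \<Rightarrow> bool" where
  "simplicial_map K L f \<longleftrightarrow> (\<forall>\<sigma>\<in>K. f ` \<sigma> \<in> L)"

text \<open>
  The geometric realization, in barycentric coordinates. For a finite complex the topology of
  pointwise convergence is the usual topology of the polyhedron.
\<close>

definition realization :: "'a set set \<Rightarrow> ('a \<Rightarrow> real) topology" where
  "realization K = top_of_set
     {x. (\<forall>v. 0 \<le> x v) \<and> {v. x v \<noteq> 0} \<in> K \<and> (\<Sum>v\<in>vertex_set K. x v) = 1}"

text \<open>The affine extension to the realization of a vertex map defined on \<open>K\<close>.\<close>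

definition realization_map :: "'a set set \<Rightarrow> ('a \<Rightarrow> 'b) \<Rightarrow> ('a \<Rightarrow> real) \<Rightarrow> ('b \<Rightarrow> real)" where
  "realization_map K f x = (\<lambda>w. \<Sum>v\<in>{v \<in> vertex_set K. f v = w}. x v)"

text \<open>
  \<open>k\<close>-connectedness: every map from a sphere of dimension \<open>0 \<le> i \<le> k\<close> is
  null-homotopic, and the space is nonempty if \<open>k \<ge> -1\<close>. Here \<open>nsphere i\<close> is the
  \<open>i\<close>-dimensional sphere.
\<close>

definition connected_upto :: "int \<Rightarrow> 'a topology \<Rightarrow> bool" where
  "connected_upto k X \<longleftrightarrow>
     (-1 \<le> k \<longrightarrow> topspace X \<noteq> {}) \<and>
     (\<forall>i::nat. int i \<le> k \<longrightarrow>
        (\<forall>f. continuous_map (nsphere i) X f \<longrightarrow>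
           (\<exists>c\<in>topspace X. homotopic_with (\<lambda>_. True) (nsphere i) X f (\<lambda>_. c))))"

section \<open>Complexes and spaces with an action of the cyclic group of order \<open>p\<close>\<close>

text \<open>
  The group is written additively in the library: its elements are the residues
  \<open>0, \<dots>, p - 1\<close> and its neutral element is \<open>0\<close>.
\<close>

abbreviation Zp :: "nat \<Rightarrow> int monoid" where
  "Zp p \<equiv> integer_mod_group p"

definition simplicial_Zp_complex ::
    "nat \<Rightarrow> 'a set set \<Rightarrow> (int \<Rightarrow> 'a \<Rightarrow> 'a) \<Rightarrow> bool" where
  "simplicial_Zp_complex p K \<phi> \<longleftrightarrow>
     abstract_complex K \<and>
     group_action (Zp p) (vertex_set K) \<phi> \<and>
     (\<forall>g\<in>carrier (Zp p). simplicial_map K K (\<phi> g))"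

text \<open>A simplex is fixed by \<open>g\<close> if it is mapped onto itself, possibly permuting its vertices.\<close>

definition free_Zp_complex ::
    "nat \<Rightarrow> 'a set set \<Rightarrow> (int \<Rightarrow> 'a \<Rightarrow> 'a) \<Rightarrow> bool" where
  "free_Zp_complex p K \<phi> \<longleftrightarrow>
     simplicial_Zp_complex p K \<phi> \<and>
     (\<forall>g\<in>carrier (Zp p). g \<noteq> \<one>\<^bsub>Zp p\<^esub> \<longrightarrow> (\<forall>\<sigma>\<in>K. \<phi> g ` \<sigma> \<noteq> \<sigma>))"

definition simplicial_Zp_map ::
    "nat \<Rightarrow> 'a set set \<Rightarrow> (int \<Rightarrow> 'a \<Rightarrow> 'a) \<Rightarrow> 'b set set \<Rightarrow> (int \<Rightarrow> 'b \<Rightarrow> 'b) \<Rightarrow>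
     ('a \<Rightarrow> 'b) \<Rightarrow> bool" where
  "simplicial_Zp_map p K \<phi> L \<psi> f \<longleftrightarrow>
     simplicial_map K L f \<and>
     (\<forall>g\<in>carrier (Zp p). \<forall>v\<in>vertex_set K. f (\<phi> g v) = \<psi> g (f v))"

definition equivariant_map ::
    "nat \<Rightarrow> 'x topology \<Rightarrow> (int \<Rightarrow> 'x \<Rightarrow> 'x) \<Rightarrow> 'y topology \<Rightarrow> (int \<Rightarrow> 'y \<Rightarrow> 'y) \<Rightarrow>
     ('x \<Rightarrow> 'y) \<Rightarrow> bool" where
  "equivariant_map p X \<alpha> Y \<beta> f \<longleftrightarrow>
     continuous_map X Y f \<and>
     (\<forall>g\<in>carrier (Zp p). \<forall>x\<in>topspace X. f (\<alpha> g x) = \<beta> g (f x))"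

definition is_EnZp :: "nat \<Rightarrow> nat \<Rightarrow> 'e set set \<Rightarrow> (int \<Rightarrow> 'e \<Rightarrow> 'e) \<Rightarrow> bool" where
  "is_EnZp p n K \<phi> \<longleftrightarrow>
     free_Zp_complex p K \<phi> \<and>
     connected_upto (int n - 1) (realization K) \<and>
     complex_dim K = n"

text \<open>
  The index of a \<open>\<int>\<^sub>p\<close>-space \<open>(X, \<alpha>)\<close>, computed with the complexes
  \<open>(E n, \<eta> n)\<close> as the chosen \<open>E\<^sub>n\<int>\<^sub>p\<close>. The infimum is the least such \<open>n\<close>,
  or \<open>\<infinity>\<close> if there is none; the index of the empty space is \<open>-1\<close>.
\<close>

definition Zp_index ::
    "nat \<Rightarrow> (nat \<Rightarrow> 'e set set) \<Rightarrow> (nat \<Rightarrow> int \<Rightarrow> 'e \<Rightarrow> 'e) \<Rightarrow>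
     'x topology \<Rightarrow> (int \<Rightarrow> 'x \<Rightarrow> 'x) \<Rightarrow> ereal" where
  "Zp_index p E \<eta> X \<alpha> =
     (if topspace X = {} then -1
      else Inf {ereal (real n) | n::nat.
             \<exists>f. equivariant_map p X \<alpha>
                   (realization (E n)) (\<lambda>g. realization_map (E n) (\<eta> n g)) f})"

definition Zp_index_complex ::
    "nat \<Rightarrow> (nat \<Rightarrow> 'e set set) \<Rightarrow> (nat \<Rightarrow> int \<Rightarrow> 'e \<Rightarrow> 'e) \<Rightarrow>
     'a set set \<Rightarrow> (int \<Rightarrow> 'a \<Rightarrow> 'a) \<Rightarrow> ereal" where
  "Zp_index_complex p E \<eta> K \<phi> =
     Zp_index p E \<eta> (realization K) (\<lambda>g. realization_map K (\<phi> g))"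

section \<open>The joins \<open>(\<sigma>\<^bsup>p-1\<^esup>\<^bsub>p-2\<^esub>)\<^bsup>*m\<^esup>\<close>\<close>

definition sigma_complex :: "nat \<Rightarrow> int set set" where
  "sigma_complex p =
     {\<tau>. \<tau> \<noteq> {} \<and> (\<exists>\<rho>. \<rho> \<subseteq> carrier (Zp p) \<and> card \<rho> = p - 1 \<and> \<tau> \<subseteq> \<rho>)}"

text \<open>Some, but not all, of the layers of a simplex of the join may be empty.\<close>

definition join_power :: "'a set set \<Rightarrow> nat \<Rightarrow> ('a \<times> nat) set set" where
  "join_power K m =
     {\<tau>. \<tau> \<noteq> {} \<and> \<tau> \<subseteq> vertex_set K \<times> {1..m} \<and>
         (\<forall>j\<in>{1..m}. {v. (v, j) \<in> \<tau>} \<in> insert {} K)}"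

definition join_action :: "nat \<Rightarrow> nat \<Rightarrow> int \<Rightarrow> int \<times> nat \<Rightarrow> int \<times> nat" where
  "join_action p m \<epsilon> =
     restrict (\<lambda>(\<epsilon>', j). (\<epsilon> \<otimes>\<^bsub>Zp p\<^esub> \<epsilon>', j)) (carrier (Zp p) \<times> {1..m})"

definition sign_part :: "(int \<times> nat) set \<Rightarrow> int \<Rightarrow> (int \<times> nat) set" where
  "sign_part \<tau> \<epsilon> = {(\<epsilon>', j). (\<epsilon>', j) \<in> \<tau> \<and> \<epsilon>' = \<epsilon>}"

end

theory Submission
  imports Defs "HOL-Number_Theory.Cong"
begin

text \<open>
  Suppose that no simplex of \<open>C\<close> is as required. For a simplex \<open>\<tau>\<close> of the join put
  \<open>h = min\<^sub>\<epsilon> |\<tau>\<^sup>\<epsilon>|\<close>, let \<open>A\<close> be the set of those \<open>\<epsilon>\<close> with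
  \<open>|\<tau>\<^sup>\<epsilon>| > h\<close>, and let the level of \<open>\<tau>\<close> be \<open>p * h + |A|\<close>.
  This is the largest size of a subset of \<open>\<tau>\<close> that is distributed over the \<open>p\<close> signs
  as evenly as possible, so it is enough to find \<open>\<sigma> \<in> C\<close> such that \<open>\<lambda>(\<sigma>)\<close>
  has level at least \<open>t + 1\<close> (\<open>balanced_subset_of_level\<close>).

  If all levels are at most \<open>t\<close>, the index of \<open>C\<close> is at most \<open>t - 1\<close>, for the
  following reason. The level grows with \<open>\<tau>\<close>. As \<open>|A| < p\<close>, the level determines
  \<open>h\<close> and \<open>|A|\<close>; hence, along a chain of simplices of the same level, \<open>A\<close> is
  constant, and if \<open>A\<close> is empty then even \<open>\<tau>\<close> is constant
  (\<open>pattern_eq_of_level_eq\<close>). As \<open>p\<close> is prime, the group acts freely on the nonempty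
  proper subsets \<open>A\<close> of itself, and on the simplices of the join. So one can attach to
  \<open>A\<close>, or to \<open>\<tau>\<close> if \<open>A\<close> is empty, a group element in an equivariant way
  (\<open>equivariant_sign\<close>). The pair of this group element and the level is a vertex of the
  \<open>t\<close>-fold join of the group with itself, and by the above a chain of simplices of
  \<open>C\<close> goes to a simplex of that join. Thus there is a simplicial equivariant map from the
  barycentric subdivision of \<open>C\<close>, and so a continuous equivariant map from \<open>C\<close>, to a free
  complex of dimension \<open>t - 1\<close> (\<open>equivariant_map_to_group_join\<close>).

  A free complex of dimension \<open>n\<close> has an equivariant map to every \<open>(n - 1)\<close>-connected
  space with an action (\<open>equivariant_map_to_connected_space\<close>): the map is extended over one
  orbit of simplices after another. With \<open>n = t - 1\<close> and the given \<open>E\<^sub>n\<close>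
  the composite \<open>C \<rightarrow> E\<^sub>n\<close> contradicts the assumption on the index.
\<close>

section \<open>Extension of continuous maps over a simplex\<close>

text \<open>Unlike \<open>realization\<close>, this does not refer to an ambient complex, so that it can be used
  for a single cell of any complex.\<close>

definition closed_simplex :: "'a set \<Rightarrow> ('a \<Rightarrow> real) set" where
  "closed_simplex \<sigma> = {x. (\<forall>v. 0 \<le> x v) \<and> (\<forall>v. v \<notin> \<sigma> \<longrightarrow> x v = 0) \<and> sum x \<sigma> = 1}"

lemma continuous_on_Min_family:
  fixes f :: "'i \<Rightarrow> 'x::topological_space \<Rightarrow> 'y::linorder_topology"
  assumes "finite I" "I \<noteq> {}" "\<And>i. i \<in> I \<Longrightarrow> continuous_on S (f i)"
  shows "continuous_on S (\<lambda>x. Min ((\<lambda>i. f i x) ` I))"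
  using assms
proof (induction I rule: finite_ne_induct)
  case (insert a I)
  then have "continuous_on S (\<lambda>x. min (f a x) (Min ((\<lambda>i. f i x) ` I)))"
    by (intro continuous_on_min) auto
  then show ?case
    using insert by simp
qed simp

lemma nsphere_eq_top_of_set:
  "nsphere n = top_of_set {u. (\<Sum>i\<le>n. (u i)\<^sup>2) = 1 \<and> (\<forall>i>n. u i = 0)}"
  by (simp add: nsphere euclidean_product_topology Collect_conj_eq)

lemma continuous_on_coordinate: "continuous_on S (\<lambda>x :: 'a \<Rightarrow> real. x v)"
  by (rule continuous_on_product_then_coordinatewise[OF continuous_on_id])

text \<open>
  A map on the boundary extends because it is null-homotopic after composition with a map from
  the sphere onto the boundary. Subtracting the last coordinate from the others and normalising
  gives \<open>\<psi>\<close>, from the simplex without its barycenter to the sphere. Subtracting the minimum and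
  normalising gives \<open>\<theta>\<close>, from the sphere to the boundary, and \<open>\<theta> \<circ> \<psi>\<close> is the identity on the
  boundary. Hence \<open>f = f \<circ> \<theta> \<circ> \<psi>\<close> there, and a contraction of \<open>f \<circ> \<theta>\<close>, run along the smallest
  coordinate, is the extension. The contraction ends halfway to the barycenter, so that \<open>\<psi>\<close> is
  only used where it is continuous.
\<close>

lemma extension_over_simplex:
  fixes \<sigma> :: "'a set" and Y :: "'b topology"
  assumes fin: "finite \<sigma>" "\<sigma> \<noteq> {}"
    and conn: "connected_upto (int (card \<sigma>) - 2) Y"
    and f: "continuous_map (top_of_set {x \<in> closed_simplex \<sigma>. \<exists>v\<in>\<sigma>. x v = 0}) Y f"
  obtains h where "continuous_map (top_of_set (closed_simplex \<sigma>)) Y h"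
    "\<And>x. x \<in> closed_simplex \<sigma> \<Longrightarrow> \<exists>v\<in>\<sigma>. x v = 0 \<Longrightarrow> h x = f x"
proof (cases "card \<sigma> = 1")
  case True
  then obtain w where w: "\<sigma> = {w}"
    using card_1_singletonE by blast
  have "topspace Y \<noteq> {}"
    using conn True by (simp add: connected_upto_def)
  then obtain y where "y \<in> topspace Y"
    by blast
  then have "continuous_map (top_of_set (closed_simplex \<sigma>)) Y (\<lambda>_. y)"
    by simp
  moreover have "\<not> (x \<in> closed_simplex \<sigma> \<and> (\<exists>v\<in>\<sigma>. x v = 0))" for x
    by (auto simp: w closed_simplex_def)
  ultimately show ?thesis
    using that by blast
next
  case False
  moreover have "card \<sigma> \<noteq> 0"
    using fin by simp
  ultimately obtain n where card: "card \<sigma> = Suc (Suc n)"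
    by (metis One_nat_def not0_implies_Suc)
  let ?I = "{..Suc n}"
  obtain e where e: "bij_betw e ?I \<sigma>"
    using ex_bij_betw_nat_finite[OF fin(1)] by (auto simp: card lessThan_Suc_atMost atLeast0LessThan)
  define k where "k = inv_into ?I e"
  have ke: "k (e i) = i" if "i \<in> ?I" for i
    using that e by (simp add: k_def bij_betw_inv_into_left)
  have ek: "e (k v) = v" "k v \<in> ?I" if "v \<in> \<sigma>" for v
    using that e unfolding k_def by (auto simp: bij_betw_inv_into_right bij_betw_def inv_into_into)
  have e_in: "e i \<in> \<sigma>" if "i \<in> ?I" for i
    using that e bij_betwE by blast
  have sum_e: "(\<Sum>i\<in>?I. g (e i)) = sum g \<sigma>" for g :: "'a \<Rightarrow> real"
    using sum.reindex_bij_betw[OF e] .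
  define w where "w = e (Suc n)"
  define r where "r x = sqrt (\<Sum>i\<le>n. (x (e i) - x w)\<^sup>2)" for x :: "'a \<Rightarrow> real"
  define \<psi> where "\<psi> x i = (if i \<in> ?I then (x (e i) - x w) / r x else 0)" for x :: "'a \<Rightarrow> real" and i
  define M where "M u = Min ((\<lambda>i. u i) ` ?I)" for u :: "nat \<Rightarrow> real"
  define S where "S u = (\<Sum>i\<in>?I. u i - M u)" for u :: "nat \<Rightarrow> real"
  define \<theta> where "\<theta> u v = (if v \<in> \<sigma> then (u (k v) - M u) / S u else 0)" for u and v
  define m where "m x = Min ((\<lambda>v. x v) ` \<sigma>)" for x :: "'a \<Rightarrow> real"
  define D where "D = real (Suc (Suc n))"
  let ?sph = "{u :: nat \<Rightarrow> real. (\<Sum>i\<le>n. (u i)\<^sup>2) = 1 \<and> (\<forall>i>n. u i = 0)}"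
  let ?bd = "{x \<in> closed_simplex \<sigma>. \<exists>v\<in>\<sigma>. x v = 0}"
  let ?col = "{x \<in> closed_simplex \<sigma>. D * m x \<le> 1/2}"
  \<comment> \<open>The barycenter is outside the collar, so the normalisation is possible there.\<close>
  have r_pos: "r x > 0" if "x \<in> ?col" for x
  proof (rule ccontr)
    assume "\<not> r x > 0"
    then have "(\<Sum>i\<le>n. (x (e i) - x w)\<^sup>2) \<le> 0"
      by (auto simp: r_def not_less)
    moreover have "(\<Sum>i\<le>n. (x (e i) - x w)\<^sup>2) \<ge> 0"
      by (intro sum_nonneg) auto
    ultimately have "\<forall>i\<in>{..n}. (x (e i) - x w)\<^sup>2 = 0"
      by (subst sum_nonneg_eq_0_iff[symmetric]) auto
    then have all: "x (e i) = x w" if "i \<in> ?I" for i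
      using that by (cases "i = Suc n") (auto simp: w_def)
    then have all': "x v = x w" if "v \<in> \<sigma>" for v
      using ek[OF that] by metis
    then have "(\<lambda>v. x v) ` \<sigma> = {x w}"
      using fin by (auto simp: image_iff)
    then have "m x = x w"
      by (simp add: m_def)
    moreover have "sum x \<sigma> = D * x w"
      using all' by (simp add: card D_def)
    ultimately show False
      using that by (auto simp: closed_simplex_def)
  qed
  have \<psi>_sph: "\<psi> x \<in> ?sph" if "x \<in> ?col" for x
  proof -
    have "(\<Sum>i\<le>n. (\<psi> x i)\<^sup>2) = (\<Sum>i\<le>n. (x (e i) - x w)\<^sup>2) / (r x)\<^sup>2"
      by (simp add: \<psi>_def power_divide sum_divide_distrib)
    also have "(\<Sum>i\<le>n. (x (e i) - x w)\<^sup>2) = (r x)\<^sup>2"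
      by (simp add: r_def sum_nonneg)
    finally have "(\<Sum>i\<le>n. (\<psi> x i)\<^sup>2) = 1"
      using r_pos[OF that] by simp
    moreover have "\<psi> x i = 0" if "i > n" for i
      using that by (cases "i = Suc n") (auto simp: \<psi>_def w_def)
    ultimately show ?thesis by blast
  qed
  have cont_m: "continuous_on T m" for T
    unfolding m_def using fin by (intro continuous_on_Min_family continuous_on_coordinate) auto
  have cont_\<psi>: "continuous_on ?col \<psi>"
  proof (rule continuous_on_coordinatewise_then_product)
    fix i
    have "continuous_on ?col r"
      unfolding r_def by (intro continuous_intros continuous_on_coordinate)
    moreover have "\<forall>x\<in>?col. r x \<noteq> 0"
      by (intro ballI) (rule less_imp_neq[OF r_pos, symmetric])
    ultimately have "continuous_on ?col (\<lambda>x. (x (e i) - x w) / r x)"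
      by (intro continuous_on_divide continuous_on_diff continuous_on_coordinate)
    then show "continuous_on ?col (\<lambda>x. \<psi> x i)"
      by (cases "i \<in> ?I") (auto simp: \<psi>_def)
  qed
  have M_le: "M u \<le> u i" if "i \<in> ?I" for u i
    using that by (auto simp: M_def)
  have M_at: "\<exists>i\<in>?I. u i = M u" for u
  proof -
    have "M u \<in> (\<lambda>i. u i) ` ?I"
      unfolding M_def by (rule Min_in) auto
    then show ?thesis by auto
  qed
  \<comment> \<open>A point of the sphere is not constant on the \<open>n + 2\<close> indices, since its last coordinate is \<open>0\<close>.\<close>
  have S_pos: "S u > 0" if "u \<in> ?sph" for u
  proof (rule ccontr)
    assume "\<not> S u > 0"
    moreover have "S u \<ge> 0"
      unfolding S_def using M_le by (intro sum_nonneg) auto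
    ultimately have "S u = 0" by simp
    then have "\<forall>i\<in>?I. u i - M u = 0"
      unfolding S_def using M_le by (subst sum_nonneg_eq_0_iff[symmetric]) auto
    moreover have "u (Suc n) = 0"
      using that by auto
    ultimately have "\<forall>i\<in>?I. u i = 0"
      by (metis atMost_iff diff_0 eq_iff_diff_eq_0 neg_equal_0_iff_equal order_refl)
    then have "(\<Sum>i\<le>n. (u i)\<^sup>2) = 0"
      by simp
    with that show False by simp
  qed
  have cont_M: "continuous_on T M" for T
    unfolding M_def by (intro continuous_on_Min_family continuous_on_coordinate) auto
  have cont_\<theta>: "continuous_on ?sph \<theta>"
  proof (rule continuous_on_coordinatewise_then_product)
    fix v
    have "continuous_on ?sph S"
      unfolding S_def by (intro continuous_intros continuous_on_coordinate cont_M)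
    moreover have "\<forall>u\<in>?sph. S u \<noteq> 0"
      by (intro ballI) (rule less_imp_neq[OF S_pos, symmetric])
    ultimately have "continuous_on ?sph (\<lambda>u. (u (k v) - M u) / S u)"
      by (intro continuous_on_divide continuous_on_diff continuous_on_coordinate cont_M)
    then show "continuous_on ?sph (\<lambda>u. \<theta> u v)"
      by (cases "v \<in> \<sigma>") (auto simp: \<theta>_def)
  qed
  have \<theta>_bd: "\<theta> u \<in> ?bd" if u: "u \<in> ?sph" for u
  proof -
    have "sum (\<theta> u) \<sigma> = (\<Sum>i\<in>?I. \<theta> u (e i))"
      by (simp only: sum_e)
    also have "\<dots> = (\<Sum>i\<in>?I. (u i - M u) / S u)"
      using e_in ke by (intro sum.cong) (auto simp: \<theta>_def)
    also have "\<dots> = S u / S u"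
      by (simp only: S_def sum_divide_distrib)
    finally have "sum (\<theta> u) \<sigma> = 1"
      using S_pos[OF u] by simp
    moreover have "0 \<le> \<theta> u v" for v
      using ek M_le S_pos[OF u] by (auto simp: \<theta>_def intro!: divide_nonneg_pos)
    moreover obtain i where "i \<in> ?I" "u i = M u"
      using M_at by blast
    then have "\<exists>v\<in>\<sigma>. \<theta> u v = 0"
      using e_in ke by (intro bexI[of _ "e i"]) (auto simp: \<theta>_def)
    ultimately show ?thesis
      by (auto simp: closed_simplex_def \<theta>_def)
  qed
  have m0: "m x = 0" if "x \<in> ?bd" for x
  proof -
    from that obtain v where v: "v \<in> \<sigma>" "x v = 0" by auto
    have "0 = x v" using v by simp
    then show ?thesis
      unfolding m_def using that v fin by (intro Min_eqI) (auto simp: closed_simplex_def)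
  qed
  have m_nonneg: "m x \<ge> 0" if "x \<in> closed_simplex \<sigma>" for x
    using that fin by (auto simp: m_def closed_simplex_def)
  have \<theta>_\<psi>: "\<theta> (\<psi> x) = x" if x: "x \<in> ?bd" for x
  proof -
    have xc: "x \<in> ?col"
      using x m0[OF x] by auto
    note r = r_pos[OF xc]
    obtain v where v: "v \<in> \<sigma>" "x v = 0" using x by auto
    have "M (\<psi> x) = - x w / r x"
      unfolding M_def
    proof (rule Min_eqI)
      show "- x w / r x \<le> y" if "y \<in> (\<lambda>i. \<psi> x i) ` ?I" for y
        using that x r by (auto simp: \<psi>_def closed_simplex_def divide_simps)
      show "- x w / r x \<in> (\<lambda>i. \<psi> x i) ` ?I"
        using v ek[of v] by (intro image_eqI[of _ _ "k v"]) (auto simp: \<psi>_def)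
    qed simp
    then have diff: "\<psi> x i - M (\<psi> x) = x (e i) / r x" if "i \<in> ?I" for i
      using that by (simp add: \<psi>_def diff_divide_distrib)
    have "S (\<psi> x) = (\<Sum>i\<in>?I. x (e i) / r x)"
      unfolding S_def using diff by (intro sum.cong) auto
    also have "\<dots> = 1 / r x"
      using x sum_e[of "\<lambda>v. x v / r x"] by (simp add: closed_simplex_def flip: sum_divide_distrib)
    finally have "S (\<psi> x) = 1 / r x" .
    then show ?thesis
      using r x ek diff by (auto simp: \<theta>_def closed_simplex_def fun_eq_iff)
  qed
  have "continuous_map (nsphere n) Y (f \<circ> \<theta>)"
    unfolding nsphere_eq_top_of_set
    by (rule continuous_map_compose[OF _ f]) (use cont_\<theta> \<theta>_bd in auto)
  moreover have "int n \<le> int (card \<sigma>) - 2"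
    by (simp add: card)
  ultimately obtain c where c: "c \<in> topspace Y"
    and "homotopic_with (\<lambda>_. True) (nsphere n) Y (f \<circ> \<theta>) (\<lambda>_. c)"
    using conn unfolding connected_upto_def by blast
  then obtain H where
    H: "continuous_map (prod_topology (top_of_set {0..1::real}) (nsphere n)) Y H"
    and H0: "\<And>u. H (0, u) = f (\<theta> u)" and H1: "\<And>u. H (1, u) = c"
    unfolding homotopic_with_def by auto
  define h where "h x = (if D * m x \<le> 1/2 then H (2 * D * m x, \<psi> x) else c)" for x
  have "continuous_map (top_of_set (closed_simplex \<sigma>)) Y h"
    unfolding h_def
  proof (rule continuous_map_cases_le)
    show "continuous_map (top_of_set (closed_simplex \<sigma>)) euclideanreal (\<lambda>x. D * m x)"
      using cont_m by (simp add: continuous_on_mult_left)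
    have "2 * D * m x \<in> {0..1}" if "x \<in> ?col" for x
    proof -
      have "0 \<le> m x" "D * m x \<le> 1/2" "0 \<le> D"
        using that m_nonneg by (auto simp: D_def)
      then have "0 \<le> D * m x" "2 * (D * m x) \<le> 1"
        by simp_all
      then show ?thesis
        by (simp only: mult.assoc atLeastAtMost_iff) simp
    qed
    then have "continuous_map (top_of_set ?col) (top_of_set {0..1}) (\<lambda>x. 2 * D * m x)"
      by (intro continuous_map_into_subtopology continuous_map_iff_continuous[THEN iffD2]
          continuous_on_mult_left cont_m) auto
    moreover have "continuous_map (top_of_set ?col) (nsphere n) \<psi>"
      unfolding nsphere_eq_top_of_set using cont_\<psi> \<psi>_sph by auto
    ultimately have "continuous_map (top_of_set ?col)
            (prod_topology (top_of_set {0..1::real}) (nsphere n)) (\<lambda>x. (2 * D * m x, \<psi> x))"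
      by (simp add: continuous_map_pairwise o_def)
    from continuous_map_compose[OF this H]
    show "continuous_map (subtopology (top_of_set (closed_simplex \<sigma>))
        {x \<in> topspace (top_of_set (closed_simplex \<sigma>)). D * m x \<le> 1/2}) Y
        (\<lambda>x. H (2 * D * m x, \<psi> x))"
      by (simp add: o_def subtopology_subtopology Collect_conj_eq inf.absorb2 Int_commute)
  qed (use c H1 in \<open>auto simp: field_simps\<close>)
  moreover have "h x = f x" if "x \<in> closed_simplex \<sigma>" "\<exists>v\<in>\<sigma>. x v = 0" for x
    using m0[of x] \<theta>_\<psi>[of x] that by (simp add: h_def H0)
  ultimately show ?thesis
    using that by blast
qed

section \<open>Group actions on complexes and on spaces\<close>

locale simplicial_action = group_action G "vertex_set K" \<phi>
  for G :: "('g, 'm) monoid_scheme" (structure) and K :: "'a set set" and \<phi> +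
  assumes complex: "abstract_complex K"
    and simplicial: "\<And>g. g \<in> carrier G \<Longrightarrow> simplicial_map K K (\<phi> g)"
begin

abbreviation act :: "'g \<Rightarrow> ('a \<Rightarrow> real) \<Rightarrow> ('a \<Rightarrow> real)" where
  "act g \<equiv> realization_map K (\<phi> g)"

abbreviation points :: "('a \<Rightarrow> real) set" where
  "points \<equiv> topspace (realization K)"

lemma is_group: "group G"
  using group_hom group_hom.axioms(1) by blast

lemma finite_vertex_set: "finite (vertex_set K)"
  using complex unfolding abstract_complex_def vertex_set_def by blast

lemma simplex_subset: "\<sigma> \<in> K \<Longrightarrow> \<sigma> \<subseteq> vertex_set K"
  by (auto simp: vertex_set_def)

lemma simplex_finite: "\<sigma> \<in> K \<Longrightarrow> finite \<sigma>" and simplex_nonempty: "\<sigma> \<in> K \<Longrightarrow> \<sigma> \<noteq> {}"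
  using complex unfolding abstract_complex_def by blast+

lemma face_closed: "\<sigma> \<in> K \<Longrightarrow> \<tau> \<subseteq> \<sigma> \<Longrightarrow> \<tau> \<noteq> {} \<Longrightarrow> \<tau> \<in> K"
  using complex unfolding abstract_complex_def by blast

lemma image_simplex: "g \<in> carrier G \<Longrightarrow> \<sigma> \<in> K \<Longrightarrow> \<phi> g ` \<sigma> \<in> K"
  using simplicial by (auto simp: simplicial_map_def)

lemma image_mult:
  "g \<in> carrier G \<Longrightarrow> h \<in> carrier G \<Longrightarrow> \<tau> \<subseteq> vertex_set K \<Longrightarrow> \<phi> (g \<otimes> h) ` \<tau> = \<phi> g ` \<phi> h ` \<tau>"
  unfolding image_image using composition_rule by (intro image_cong refl) blast

lemma image_one: "\<tau> \<subseteq> vertex_set K \<Longrightarrow> \<phi> \<one> ` \<tau> = \<tau>"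
proof -
  assume "\<tau> \<subseteq> vertex_set K"
  then have "\<phi> \<one> v = v" if "v \<in> \<tau>" for v
    using that fun_cong[OF id_eq_one, of v] by auto
  then show "\<phi> \<one> ` \<tau> = \<tau>"
    by force
qed

lemma points_iff:
  "x \<in> points \<longleftrightarrow> (\<forall>v. 0 \<le> x v) \<and> {v. x v \<noteq> 0} \<in> K \<and> sum x (vertex_set K) = 1"
  by (simp add: realization_def)

lemma point_outside:
  assumes "x \<in> points" "w \<notin> vertex_set K"
  shows "x w = 0"
proof -
  have "{v. x v \<noteq> 0} \<subseteq> vertex_set K"
    using assms(1) by (intro simplex_subset) (simp add: points_iff)
  then show ?thesis
    using assms(2) by blast
qed

lemma act_at_image:
  assumes "g \<in> carrier G" "v \<in> vertex_set K"
  shows "act g x (\<phi> g v) = x v"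
proof -
  have "{u \<in> vertex_set K. \<phi> g u = \<phi> g v} = {v}"
    using inj_prop[OF assms(1)] assms(2) by (auto dest: inj_onD)
  then show ?thesis
    by (simp add: realization_map_def)
qed

lemma act_outside:
  assumes "g \<in> carrier G" "w \<notin> vertex_set K"
  shows "act g x w = 0"
proof -
  have "{u \<in> vertex_set K. \<phi> g u = w} = {}"
    using assms element_image by blast
  then show ?thesis
    by (simp only: realization_map_def sum.empty)
qed

lemma act_eqI:
  assumes "g \<in> carrier G" "\<And>w. w \<notin> vertex_set K \<Longrightarrow> y w = 0"
    and "\<And>v. v \<in> vertex_set K \<Longrightarrow> y (\<phi> g v) = x v"
  shows "act g x = y"
proof
  fix w
  show "act g x w = y w"
  proof (cases "w \<in> vertex_set K")
    case True
    then obtain v where "v \<in> vertex_set K" "w = \<phi> g v"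
      using surj_prop[OF assms(1)] by (metis imageE)
    then show ?thesis
      using assms act_at_image by simp
  qed (use assms act_outside in simp)
qed

lemma support_act:
  assumes "g \<in> carrier G" "x \<in> points"
  shows "{w. act g x w \<noteq> 0} = \<phi> g ` {v. x v \<noteq> 0}"
proof (intro equalityI subsetI)
  fix w assume w: "w \<in> {w. act g x w \<noteq> 0}"
  then have "w \<in> vertex_set K"
    using act_outside[OF assms(1)] by blast
  then obtain v where "v \<in> vertex_set K" "w = \<phi> g v"
    using surj_prop[OF assms(1)] by (metis imageE)
  with w show "w \<in> \<phi> g ` {v. x v \<noteq> 0}"
    using act_at_image[OF assms(1)] by auto
next
  fix w assume "w \<in> \<phi> g ` {v. x v \<noteq> 0}"
  then obtain v where "x v \<noteq> 0" "w = \<phi> g v" by auto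
  moreover from this have "v \<in> vertex_set K"
    using point_outside[OF assms(2)] by blast
  ultimately show "w \<in> {w. act g x w \<noteq> 0}"
    using act_at_image[OF assms(1)] by simp
qed

lemma act_points:
  assumes "g \<in> carrier G" "x \<in> points"
  shows "act g x \<in> points"
proof -
  have "bij_betw (\<phi> g) (vertex_set K) (vertex_set K)"
    using assms(1) by (simp add: bij_betw_def inj_prop surj_prop)
  then have "sum (act g x) (vertex_set K) = (\<Sum>v\<in>vertex_set K. act g x (\<phi> g v))"
    by (rule sum.reindex_bij_betw[symmetric])
  also have "\<dots> = sum x (vertex_set K)"
    using act_at_image[OF assms(1)] by (intro sum.cong refl)
  finally have "sum (act g x) (vertex_set K) = 1"
    using assms(2) unfolding points_iff by simp
  moreover have "0 \<le> act g x w" for w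
    using assms(2) unfolding realization_map_def points_iff by (intro sum_nonneg) blast
  moreover have "\<phi> g ` {v. x v \<noteq> 0} \<in> K"
    using assms(2) unfolding points_iff by (intro image_simplex[OF assms(1)]) blast
  ultimately show ?thesis
    unfolding points_iff support_act[OF assms] by blast
qed

lemma act_one:
  assumes "x \<in> points"
  shows "act \<one> x = x"
proof (rule act_eqI)
  show "\<one> \<in> carrier G"
    using is_group by (simp add: group.is_monoid monoid.one_closed)
  show "x (\<phi> \<one> v) = x v" if "v \<in> vertex_set K" for v
    using that by (simp flip: id_eq_one)
qed (use assms point_outside in blast)

lemma act_mult:
  assumes "g \<in> carrier G" "h \<in> carrier G" "x \<in> points"
  shows "act (g \<otimes> h) x = act g (act h x)"
proof (rule act_eqI)
  show "g \<otimes> h \<in> carrier G"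
    using assms is_group by (simp add: group.is_monoid monoid.m_closed)
  show "act g (act h x) w = 0" if "w \<notin> vertex_set K" for w
    using act_outside[OF assms(1) that] .
  show "act g (act h x) (\<phi> (g \<otimes> h) v) = x v" if "v \<in> vertex_set K" for v
    using that assms element_image[OF assms(2) that refl]
    by (simp add: composition_rule act_at_image)
qed

lemma continuous_on_act: "continuous_on S (act g)"
  unfolding realization_map_def
  by (intro continuous_on_coordinatewise_then_product continuous_on_sum continuous_on_coordinate)

end

lemma connected_upto_mono: "connected_upto k X \<Longrightarrow> k' \<le> k \<Longrightarrow> connected_upto k' X"
  unfolding connected_upto_def by (meson order_trans)

text \<open>The laws are only required on the points of the space: the realization of a vertex action
  obeys them on the points of the realization, not on all real functions.\<close>

locale topological_action = group G for G :: "('g, 'm) monoid_scheme" (structure) +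
  fixes Y :: "'y topology" and \<beta> :: "'g \<Rightarrow> 'y \<Rightarrow> 'y"
  assumes continuous_action: "\<And>g. g \<in> carrier G \<Longrightarrow> continuous_map Y Y (\<beta> g)"
    and action_one: "\<And>y. y \<in> topspace Y \<Longrightarrow> \<beta> \<one> y = y"
    and action_mult: "\<And>g h y. g \<in> carrier G \<Longrightarrow> h \<in> carrier G \<Longrightarrow> y \<in> topspace Y \<Longrightarrow>
      \<beta> (g \<otimes> h) y = \<beta> g (\<beta> h y)"
begin
lemma action_inv:
  assumes "g \<in> carrier G" "y \<in> topspace Y"
  shows "\<beta> g (\<beta> (inv g) y) = y"
  using assms action_mult[of g "inv g" y] by (simp add: action_one)
end

lemma (in simplicial_action) topological_action_realization:
  "topological_action G (realization K) act"
proof -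
  interpret group G by (rule is_group)
  show ?thesis
  proof
    fix g assume g: "g \<in> carrier G"
    show "continuous_map (realization K) (realization K) (act g)"
      unfolding realization_def
      using continuous_on_act act_points[OF g] by (auto simp: realization_def)
  qed (simp_all only: act_one act_mult)
qed

section \<open>Equivariant maps to highly connected spaces\<close>

locale free_simplicial_action = simplicial_action G K \<phi>
  for G :: "('g, 'm) monoid_scheme" (structure) and K :: "'a set set" and \<phi> +
  assumes finite_group: "finite (carrier G)"
    and free: "\<And>g \<sigma>. g \<in> carrier G \<Longrightarrow> \<sigma> \<in> K \<Longrightarrow> \<phi> g ` \<sigma> = \<sigma> \<Longrightarrow> g = \<one>"
begin

lemma free_orbit:
  assumes "g \<in> carrier G" "h \<in> carrier G" "\<sigma> \<in> K" "\<phi> g ` \<sigma> = \<phi> h ` \<sigma>"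
  shows "g = h"
proof -
  interpret group G by (rule is_group)
  note sub = simplex_subset[OF assms(3)]
  have "\<phi> (inv h \<otimes> g) ` \<sigma> = \<phi> (inv h \<otimes> h) ` \<sigma>"
    using assms sub by (simp only: image_mult inv_closed)
  then have "\<phi> (inv h \<otimes> g) ` \<sigma> = \<sigma>"
    using assms sub by (simp add: image_one)
  then have "inv h \<otimes> g = \<one>"
    using assms by (intro free[of _ \<sigma>]) auto
  then show ?thesis
    using assms inv_solve_left' by force
qed

definition points_over :: "'a set set \<Rightarrow> ('a \<Rightarrow> real) set" where
  "points_over L = {x \<in> points. {v. x v \<noteq> 0} \<in> L}"

definition invariant_subcomplex :: "'a set set \<Rightarrow> bool" where
  "invariant_subcomplex L \<longleftrightarrow> L \<subseteq> K \<and> (\<forall>\<sigma>\<in>L. \<forall>\<tau>. \<tau> \<subseteq> \<sigma> \<longrightarrow> \<tau> \<noteq> {} \<longrightarrow> \<tau> \<in> L) \<and>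
     (\<forall>g\<in>carrier G. \<forall>\<sigma>\<in>L. \<phi> g ` \<sigma> \<in> L)"

definition orbit_of :: "'a set \<Rightarrow> 'a set set" where
  "orbit_of \<sigma> = (\<lambda>g. \<phi> g ` \<sigma>) ` carrier G"

lemma closed_supported: "closed {x :: 'a \<Rightarrow> real. {v. x v \<noteq> 0} \<subseteq> A}"
proof -
  have "{x :: 'a \<Rightarrow> real. {v. x v \<noteq> 0} \<subseteq> A} = (\<Inter>v\<in>-A. {x. x v = 0})"
    by auto
  moreover have "closed {x :: 'a \<Rightarrow> real. x v = 0}" for v
    by (intro closed_Collect_eq continuous_on_coordinate continuous_on_const)
  ultimately show ?thesis
    by auto
qed

lemma supported_in_closed_simplex:
  assumes "x \<in> points" "{v. x v \<noteq> 0} \<subseteq> \<sigma>" "\<sigma> \<in> K"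
  shows "x \<in> closed_simplex \<sigma>"
proof -
  have "sum x (vertex_set K) = sum x \<sigma>"
    using assms simplex_subset finite_vertex_set by (intro sum.mono_neutral_right) auto
  then show ?thesis
    using assms by (auto simp: points_iff closed_simplex_def)
qed

lemma boundary_point:
  assumes x: "x \<in> closed_simplex \<sigma>" "\<exists>v\<in>\<sigma>. x v = 0"
    and \<sigma>: "\<sigma> \<in> K" "\<And>\<tau>. \<tau> \<subset> \<sigma> \<Longrightarrow> \<tau> \<noteq> {} \<Longrightarrow> \<tau> \<in> L" and "L \<subseteq> K"
  shows "x \<in> points_over L"
proof -
  have "{v. x v \<noteq> 0} \<subset> \<sigma>"
    using x by (auto simp: closed_simplex_def)
  moreover have "{v. x v \<noteq> 0} \<noteq> {}"
  proof
    assume "{v. x v \<noteq> 0} = {}"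
    then have "sum x \<sigma> = 0"
      by simp
    then show False
      using x by (simp add: closed_simplex_def)
  qed
  ultimately have "{v. x v \<noteq> 0} \<in> L"
    using \<sigma> by blast
  moreover have "sum x (vertex_set K) = sum x \<sigma>"
    using x \<sigma>(1) simplex_subset finite_vertex_set
    by (intro sum.mono_neutral_right) (auto simp: closed_simplex_def)
  ultimately show ?thesis
    using x \<open>L \<subseteq> K\<close> by (auto simp: points_over_def points_iff closed_simplex_def)
qed

text \<open>
  Extend over the single simplex \<open>\<sigma>\<close> and transport the extension \<open>h\<close> to \<open>g \<sigma>\<close> as
  \<open>g \<circ> h \<circ> g\<inverse>\<close>. Freeness makes this well defined: two different translates of \<open>\<sigma>\<close> only meet
  in their boundaries, where everything agrees with the equivariant map \<open>F\<close> already given.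
\<close>

lemma equivariant_extension_over_orbit:
  assumes "topological_action G Y \<beta>"
    and L: "invariant_subcomplex L"
    and \<sigma>: "\<sigma> \<in> K" "\<sigma> \<notin> L" "\<And>\<tau>. \<tau> \<subset> \<sigma> \<Longrightarrow> \<tau> \<noteq> {} \<Longrightarrow> \<tau> \<in> L"
    and conn: "connected_upto (int (card \<sigma>) - 2) Y"
    and F: "continuous_map (top_of_set (points_over L)) Y F"
    and F_eq: "\<And>g x. g \<in> carrier G \<Longrightarrow> x \<in> points_over L \<Longrightarrow> F (act g x) = \<beta> g (F x)"
  obtains F' where "continuous_map (top_of_set (points_over (L \<union> orbit_of \<sigma>))) Y F'"
    "\<And>g x. g \<in> carrier G \<Longrightarrow> x \<in> points_over (L \<union> orbit_of \<sigma>) \<Longrightarrow> F' (act g x) = \<beta> g (F' x)"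
proof -
  interpret Y: topological_action G Y \<beta> by fact
  have LK: "L \<subseteq> K" and L_face: "\<And>\<rho> \<tau>. \<rho> \<in> L \<Longrightarrow> \<tau> \<subseteq> \<rho> \<Longrightarrow> \<tau> \<noteq> {} \<Longrightarrow> \<tau> \<in> L"
    and L_image: "\<And>g \<rho>. g \<in> carrier G \<Longrightarrow> \<rho> \<in> L \<Longrightarrow> \<phi> g ` \<rho> \<in> L"
    using L by (auto simp: invariant_subcomplex_def)
  note \<sigma>_sub = simplex_subset[OF \<sigma>(1)]
  let ?bd = "{x \<in> closed_simplex \<sigma>. \<exists>v\<in>\<sigma>. x v = 0}"
  have "?bd \<subseteq> points_over L"
    using boundary_point \<sigma> LK by blast
  then have "continuous_map (top_of_set ?bd) Y F"
    using F by (rule continuous_map_from_subtopology_mono[rotated])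
  then obtain h where h: "continuous_map (top_of_set (closed_simplex \<sigma>)) Y h"
    and h_bd: "\<And>x. x \<in> closed_simplex \<sigma> \<Longrightarrow> \<exists>v\<in>\<sigma>. x v = 0 \<Longrightarrow> h x = F x"
    using extension_over_simplex[OF simplex_finite[OF \<sigma>(1)] simplex_nonempty[OF \<sigma>(1)] conn]
    by blast
  define X where "X = points_over (L \<union> orbit_of \<sigma>)"
  have XK: "X \<subseteq> points"
    by (auto simp: X_def points_over_def)
  \<comment> \<open>The closed pieces to be glued: the old part, and the closed translates of \<open>\<sigma>\<close>.\<close>
  define T where "T i = (case i of None \<Rightarrow> points_over L
      | Some g \<Rightarrow> {x \<in> X. {v. x v \<noteq> 0} \<subseteq> \<phi> g ` \<sigma>})" for i
  have T_None: "T None = points_over L"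
    by (simp add: T_def)
  have T_Some: "T (Some g) = {x \<in> X. {v. x v \<noteq> 0} \<subseteq> \<phi> g ` \<sigma>}" for g
    by (simp add: T_def)
  define f where "f i = (case i of None \<Rightarrow> F
      | Some g \<Rightarrow> \<beta> g \<circ> h \<circ> act (inv g))" for i
  let ?J = "insert None (Some ` carrier G)"
  have pull: "act (inv g) x \<in> closed_simplex \<sigma>" if "g \<in> carrier G" "x \<in> T (Some g)" for g x
  proof (rule supported_in_closed_simplex)
    have x: "x \<in> points" "{v. x v \<noteq> 0} \<subseteq> \<phi> g ` \<sigma>"
      using that XK by (auto simp: T_def)
    show "act (inv g) x \<in> points"
      using that x by (simp add: act_points)
    have "{v. act (inv g) x v \<noteq> 0} \<subseteq> \<phi> (inv g) ` \<phi> g ` \<sigma>"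
      using that x by (subst support_act) auto
    also have "\<dots> = \<sigma>"
      using that \<sigma>_sub by (simp add: image_one flip: image_mult)
    finally show "{v. act (inv g) x v \<noteq> 0} \<subseteq> \<sigma>" .
  qed fact
  have F_space: "F x \<in> topspace Y" if "x \<in> points_over L" for x
    using F that by (auto simp: continuous_map_def)
  have act_part: "act g x \<in> points_over L" if "g \<in> carrier G" "x \<in> points_over L" for g x
    using that L_image by (auto simp: points_over_def act_points support_act)
  have agree_L: "f (Some g) x = F x" if g: "g \<in> carrier G" and x: "x \<in> T (Some g)" "x \<in> points_over L" for g x
  proof -
    let ?z = "act (inv g) x"
    have z: "?z \<in> closed_simplex \<sigma>" "?z \<in> points_over L"
      using pull g x act_part by auto
    then have "{v. ?z v \<noteq> 0} \<noteq> \<sigma>"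
      using \<sigma>(2) by (auto simp: points_over_def)
    then have "\<exists>v\<in>\<sigma>. ?z v = 0"
      using z(1) by (auto simp: closed_simplex_def)
    then have "f (Some g) x = \<beta> g (F ?z)"
      using z h_bd by (simp add: f_def)
    also have "\<dots> = F x"
      using g x F_eq F_space Y.action_inv by simp
    finally show ?thesis .
  qed
  have orbit_point: "\<exists>g\<in>carrier G. {v. x v \<noteq> 0} = \<phi> g ` \<sigma>" if "x \<in> X" "x \<notin> points_over L" for x
  proof -
    have "{v. x v \<noteq> 0} \<in> orbit_of \<sigma>"
      using that unfolding X_def points_over_def by blast
    then show ?thesis
      unfolding orbit_of_def by blast
  qed
  have orbit_cell: "\<phi> k ` \<sigma> = {v. x v \<noteq> 0}"
    if "x \<in> X" "x \<notin> points_over L" "k \<in> carrier G" "{v. x v \<noteq> 0} \<subseteq> \<phi> k ` \<sigma>" for x k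
  proof -
    from orbit_point[OF that(1,2)]
    obtain g where g: "g \<in> carrier G" "{v. x v \<noteq> 0} = \<phi> g ` \<sigma>" ..
    have card: "card (\<phi> l ` \<sigma>) = card \<sigma>" if "l \<in> carrier G" for l
      by (rule card_image, rule inj_on_subset[OF inj_prop[OF that] \<sigma>_sub])
    have "\<phi> g ` \<sigma> = \<phi> k ` \<sigma>"
    proof (rule card_seteq)
      show "finite (\<phi> k ` \<sigma>)"
        by (rule finite_imageI[OF simplex_finite[OF \<sigma>(1)]])
      show "\<phi> g ` \<sigma> \<subseteq> \<phi> k ` \<sigma>"
        using that(4) unfolding g(2) .
      show "card (\<phi> k ` \<sigma>) \<le> card (\<phi> g ` \<sigma>)"
        unfolding card[OF g(1)] card[OF that(3)] ..
    qed
    then show ?thesis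
      unfolding g(2) ..
  qed
  have agree: "f i x = f j x" if "i \<in> ?J" "j \<in> ?J" and x: "x \<in> X" "x \<in> T i" "x \<in> T j" for i j x
  proof (cases "x \<in> points_over L")
    case True
    have "f l x = F x" if "l \<in> ?J" "x \<in> T l" for l
    proof (cases l)
      case (Some g)
      then show ?thesis
        using that True agree_L by blast
    qed (simp add: f_def)
    then show ?thesis
      using that by simp
  next
    case False
    then have "i \<noteq> None" "j \<noteq> None"
      using x by (metis T_None)+
    with that obtain g k where gk: "i = Some g" "j = Some k" "g \<in> carrier G" "k \<in> carrier G"
      by blast
    then have "{v. x v \<noteq> 0} \<subseteq> \<phi> g ` \<sigma>" "{v. x v \<noteq> 0} \<subseteq> \<phi> k ` \<sigma>"
      using x by (simp_all add: T_def)
    then have "\<phi> g ` \<sigma> = \<phi> k ` \<sigma>"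
      using orbit_cell[OF x(1) False] gk(3,4) by metis
    then have "g = k"
      using gk free_orbit \<sigma>(1) by blast
    then show ?thesis
      using gk by simp
  qed
  have T_sub: "T i \<subseteq> X" for i
    by (cases i) (auto simp: T_def X_def points_over_def)
  have cover: "X \<subseteq> \<Union> (T ` ?J)"
  proof
    fix x assume x: "x \<in> X"
    show "x \<in> \<Union> (T ` ?J)"
    proof (cases "x \<in> points_over L")
      case False
      then obtain g where "g \<in> carrier G" "{v. x v \<noteq> 0} = \<phi> g ` \<sigma>"
        using orbit_point[OF x] by blast
      then have "x \<in> T (Some g)"
        using x by (simp add: T_def)
      then show ?thesis
        using \<open>g \<in> carrier G\<close> by blast
    qed (auto simp: T_def)
  qed
  have closed_T: "closedin (top_of_set X) (T i)" if "i \<in> ?J" for i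
  proof (cases i)
    case (Some g)
    then have "T i = X \<inter> {x. {v. x v \<noteq> 0} \<subseteq> \<phi> g ` \<sigma>}"
      unfolding Some T_Some by blast
    then show ?thesis
      unfolding closedin_closed using closed_supported by blast
  next
    case None
    have "points_over L = X \<inter> (\<Union>\<tau>\<in>L. {x. {v. x v \<noteq> 0} \<subseteq> \<tau>})"
    proof (intro equalityI subsetI)
      fix x assume x: "x \<in> X \<inter> (\<Union>\<tau>\<in>L. {x. {v. x v \<noteq> 0} \<subseteq> \<tau>})"
      then have "x \<in> points"
        using XK by blast
      then have "{v. x v \<noteq> 0} \<in> K"
        unfolding points_iff by blast
      then have "{v. x v \<noteq> 0} \<noteq> {}"
        by (rule simplex_nonempty)
      moreover obtain \<tau> where "\<tau> \<in> L" "{v. x v \<noteq> 0} \<subseteq> \<tau>"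
        using x by blast
      ultimately have "{v. x v \<noteq> 0} \<in> L"
        using L_face by blast
      with \<open>x \<in> points\<close> show "x \<in> points_over L"
        unfolding points_over_def by blast
    next
      fix x assume "x \<in> points_over L"
      then show "x \<in> X \<inter> (\<Union>\<tau>\<in>L. {x. {v. x v \<noteq> 0} \<subseteq> \<tau>})"
        unfolding points_over_def X_def by blast
    qed
    moreover have "finite L"
      using LK complex unfolding abstract_complex_def by (blast intro: finite_subset)
    then have "closed (\<Union>\<tau>\<in>L. {x :: 'a \<Rightarrow> real. {v. x v \<noteq> 0} \<subseteq> \<tau>})"
      using closed_supported by (intro closed_UN) auto
    ultimately show ?thesis
      unfolding None T_None closedin_closed by blast
  qed
  have cont_f: "continuous_map (subtopology (top_of_set X) (T i)) Y (f i)" if "i \<in> ?J" for i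
  proof -
    have "continuous_map (top_of_set (T i)) Y (f i)"
    proof (cases i)
      case (Some g)
      with that have g: "g \<in> carrier G" by auto
      have "continuous_map (top_of_set (T i)) (top_of_set (closed_simplex \<sigma>)) (act (inv g))"
        using pull[OF g] unfolding Some
        by (intro continuous_map_into_subtopology continuous_map_iff_continuous[THEN iffD2]
            continuous_on_act) (rule Pi_I, simp)
      then have "continuous_map (top_of_set (T i)) Y (h \<circ> act (inv g))"
        using h by (rule continuous_map_compose)
      from continuous_map_compose[OF this Y.continuous_action[OF g]] show ?thesis
        by (simp add: Some f_def o_assoc)
    next
      case None
      then show ?thesis
        using F by (simp add: T_None f_def)
    qed
    then show ?thesis
      unfolding subtopology_subtopology inf.absorb2[OF T_sub] .
  qed
  obtain F' where F': "continuous_map (top_of_set X) Y F'"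
    and F'_f: "\<And>x i. i \<in> ?J \<Longrightarrow> x \<in> X \<inter> T i \<Longrightarrow> F' x = f i x"
  proof (rule pasting_lemma_exists_closed[of ?J "top_of_set X" T Y f])
    show "finite ?J"
      using finite_group by simp
    show "topspace (top_of_set X) \<subseteq> \<Union> (T ` ?J)"
      using cover by simp
    show "f i x = f j x" if "i \<in> ?J" "j \<in> ?J" "x \<in> topspace (top_of_set X) \<inter> T i \<inter> T j" for i j x
      using agree[OF that(1,2)] that(3) by simp
  qed (use closed_T cont_f in \<open>simp_all only: topspace_euclidean_subtopology\<close>)
  have "F' (act k x) = \<beta> k (F' x)" if k: "k \<in> carrier G" and x: "x \<in> X" for k x
  proof (cases "x \<in> points_over L")
    case True
    then have "x \<in> X \<inter> T None" "act k x \<in> X \<inter> T None"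
      using act_part[OF k] T_sub[of None] unfolding T_None by blast+
    then have "F' x = F x" "F' (act k x) = F (act k x)"
      using F'_f[of None] by (simp_all add: f_def)
    then show ?thesis
      using F_eq[OF k True] by simp
  next
    case False
    from orbit_point[OF x this]
    obtain g where g: "g \<in> carrier G" "{v. x v \<noteq> 0} = \<phi> g ` \<sigma>" ..
    have xp: "x \<in> points"
      using x XK by blast
    have kg: "k \<otimes> g \<in> carrier G"
      using k g by simp
    have supp: "{v. act k x v \<noteq> 0} = \<phi> (k \<otimes> g) ` \<sigma>"
      unfolding support_act[OF k xp] g(2) image_mult[OF k g(1) \<sigma>_sub] ..
    have "act k x \<in> X"
      unfolding X_def points_over_def using supp kg act_points[OF k xp] unfolding orbit_of_def by blast
    then have kx: "act k x \<in> X \<inter> T (Some (k \<otimes> g))"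
      unfolding T_Some using equalityD1[OF supp] by blast
    have xT: "x \<in> X \<inter> T (Some g)"
      unfolding T_Some using x equalityD1[OF g(2)] by blast
    have "act (inv (k \<otimes> g)) (act k x) = act (inv (k \<otimes> g) \<otimes> k) x"
      using act_mult[OF Y.inv_closed[OF kg] k xp] ..
    also have "inv (k \<otimes> g) \<otimes> k = inv g"
      using k g by (simp add: Y.inv_mult_group Y.m_assoc)
    finally have "F' (act k x) = \<beta> (k \<otimes> g) (h (act (inv g) x))"
      using F'_f[OF _ kx] kg by (simp add: f_def)
    also have "\<dots> = \<beta> k (\<beta> g (h (act (inv g) x)))"
    proof (rule Y.action_mult[OF k g(1)])
      have "act (inv g) x \<in> closed_simplex \<sigma>"
        using g(1) xT by (intro pull) blast+
      then show "h (act (inv g) x) \<in> topspace Y"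
        using h by (auto simp: continuous_map_def)
    qed
    also have "\<beta> g (h (act (inv g) x)) = F' x"
      using F'_f[OF _ xT] g(1) by (simp add: f_def)
    finally show ?thesis .
  qed
  with F' that show ?thesis
    unfolding X_def by blast
qed

text \<open>
  A maximal invariant subcomplex on which an equivariant map exists is the whole complex:
  a smallest simplex outside it has its boundary inside, so that the map extends over its orbit.
\<close>

theorem equivariant_map_to_connected_space:
  assumes Y: "topological_action G Y \<beta>" and conn: "connected_upto (int n - 1) Y"
    and dim: "\<And>\<sigma>. \<sigma> \<in> K \<Longrightarrow> card \<sigma> \<le> Suc n"
  obtains F where "continuous_map (realization K) Y F"
    "\<And>g x. g \<in> carrier G \<Longrightarrow> x \<in> points \<Longrightarrow> F (act g x) = \<beta> g (F x)"
proof -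
  define good where "good L \<longleftrightarrow> invariant_subcomplex L \<and>
    (\<exists>F. continuous_map (top_of_set (points_over L)) Y F \<and>
      (\<forall>g\<in>carrier G. \<forall>x\<in>points_over L. F (act g x) = \<beta> g (F x)))" for L
  have finK: "finite K"
    using complex unfolding abstract_complex_def by blast
  have "points_over {} = {}"
    by (simp add: points_over_def)
  moreover have "invariant_subcomplex {}"
    by (simp add: invariant_subcomplex_def)
  moreover have "continuous_map (top_of_set {}) Y (\<lambda>_. undefined)"
    by simp
  ultimately have "good {}"
    unfolding good_def by (metis empty_iff)
  moreover have "{L. good L} \<subseteq> Pow K"
  proof (rule subsetI, rule PowI)
    fix L assume "L \<in> {L. good L}"
    then show "L \<subseteq> K"
      unfolding mem_Collect_eq good_def invariant_subcomplex_def by (elim conjE)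
  qed
  then have "finite {L. good L}"
    using finK by (rule finite_subset[OF _ finite_Pow_iff[THEN iffD2]])
  ultimately have "\<exists>L\<in>{L. good L}. {} \<subseteq> L \<and> (\<forall>L'\<in>{L. good L}. L \<subseteq> L' \<longrightarrow> L = L')"
    by (intro finite_has_maximal2) simp_all
  then obtain L where L: "good L" and max: "\<And>L'. good L' \<Longrightarrow> L \<subseteq> L' \<Longrightarrow> L' = L"
    by simp metis
  have inv: "invariant_subcomplex L"
    using L by (simp add: good_def)
  have "L = K"
  proof (rule ccontr)
    assume "L \<noteq> K"
    then obtain \<rho> where "\<rho> \<in> K - L"
      using inv unfolding invariant_subcomplex_def by blast
    then have "\<exists>\<sigma>. \<sigma> \<in> K - L \<and> (\<forall>\<tau>. \<tau> \<in> K - L \<longrightarrow> card \<sigma> \<le> card \<tau>)"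
      by (rule ex_has_least_nat[of "\<lambda>\<sigma>. \<sigma> \<in> K - L"])
    then obtain \<sigma> where \<sigma>: "\<sigma> \<in> K" "\<sigma> \<notin> L"
      and min: "\<And>\<tau>. \<tau> \<in> K - L \<Longrightarrow> card \<sigma> \<le> card \<tau>"
      by blast
    have faces: "\<tau> \<in> L" if "\<tau> \<subset> \<sigma>" "\<tau> \<noteq> {}" for \<tau>
    proof (rule ccontr)
      assume "\<tau> \<notin> L"
      moreover have "\<tau> \<in> K"
        using \<sigma>(1) that by (intro face_closed[of \<sigma> \<tau>]) auto
      ultimately have "card \<sigma> \<le> card \<tau>"
        by (intro min) blast
      moreover have "card \<tau> < card \<sigma>"
        by (rule psubset_card_mono[OF simplex_finite[OF \<sigma>(1)] that(1)])
      ultimately show False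
        by simp
    qed
    have "connected_upto (int (card \<sigma>) - 2) Y"
      using dim[OF \<sigma>(1)] by (intro connected_upto_mono[OF conn]) simp
    moreover obtain F where "continuous_map (top_of_set (points_over L)) Y F"
      "\<And>g x. g \<in> carrier G \<Longrightarrow> x \<in> points_over L \<Longrightarrow> F (act g x) = \<beta> g (F x)"
      using L unfolding good_def by blast
    ultimately obtain F' where
      F': "continuous_map (top_of_set (points_over (L \<union> orbit_of \<sigma>))) Y F'"
        "\<And>g x. g \<in> carrier G \<Longrightarrow> x \<in> points_over (L \<union> orbit_of \<sigma>) \<Longrightarrow> F' (act g x) = \<beta> g (F' x)"
      using equivariant_extension_over_orbit[OF Y inv \<sigma> faces] by blast
    interpret group G by (rule is_group)
    have "invariant_subcomplex (L \<union> orbit_of \<sigma>)"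
      unfolding invariant_subcomplex_def
    proof (intro conjI ballI allI impI)
      show "L \<union> orbit_of \<sigma> \<subseteq> K"
      proof (rule Un_least)
        show "L \<subseteq> K"
          using inv unfolding invariant_subcomplex_def by (elim conjE)
        show "orbit_of \<sigma> \<subseteq> K"
          unfolding orbit_of_def by (rule image_subsetI) (rule image_simplex[OF _ \<sigma>(1)])
      qed
      show "\<phi> g ` \<rho> \<in> L \<union> orbit_of \<sigma>" if g: "g \<in> carrier G" and \<rho>: "\<rho> \<in> L \<union> orbit_of \<sigma>" for g \<rho>
      proof (cases "\<rho> \<in> L")
        case False
        with \<rho> obtain k where k: "k \<in> carrier G" "\<rho> = \<phi> k ` \<sigma>"
          unfolding orbit_of_def by blast
        then have "\<phi> g ` \<rho> = \<phi> (g \<otimes> k) ` \<sigma>"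
          using g image_mult[OF _ _ simplex_subset[OF \<sigma>(1)]] by simp
        then show ?thesis
          using g k unfolding orbit_of_def by blast
      qed (use g inv in \<open>unfold invariant_subcomplex_def, blast\<close>)
      show "\<tau> \<in> L \<union> orbit_of \<sigma>" if "\<rho> \<in> L \<union> orbit_of \<sigma>" "\<tau> \<subseteq> \<rho>" "\<tau> \<noteq> {}" for \<rho> \<tau>
      proof (cases "\<rho> \<in> L \<or> \<tau> = \<rho>")
        case True
        then show ?thesis
          using that inv unfolding invariant_subcomplex_def by blast
      next
        case False
        with that(1) obtain g where g: "g \<in> carrier G" "\<rho> = \<phi> g ` \<sigma>"
          unfolding orbit_of_def by blast
        define \<tau>' where "\<tau>' = {v \<in> \<sigma>. \<phi> g v \<in> \<tau>}"
        have \<tau>: "\<tau> = \<phi> g ` \<tau>'"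
          using that(2) unfolding g(2) \<tau>'_def by blast
        have "\<tau>' \<noteq> \<sigma>"
          using False \<tau> g(2) by blast
        then have "\<tau>' \<subset> \<sigma>"
          unfolding \<tau>'_def by blast
        moreover have "\<tau>' \<noteq> {}"
          using that(3) \<tau> by blast
        ultimately have "\<tau>' \<in> L"
          by (rule faces)
        then show ?thesis
          using g(1) inv unfolding \<tau> invariant_subcomplex_def by blast
      qed
    qed
    then have "good (L \<union> orbit_of \<sigma>)"
      using F' unfolding good_def by blast
    then have "orbit_of \<sigma> \<subseteq> L"
      using max[of "L \<union> orbit_of \<sigma>"] by blast
    moreover have "\<sigma> \<in> orbit_of \<sigma>"
      unfolding orbit_of_def 
      by (rule image_eqI[of _ _ "\<one>"]) (simp_all add: image_one simplex_subset \<sigma>(1))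
    ultimately show False
      using \<sigma> by blast
  qed
  have "points_over K = points"
    unfolding points_over_def using points_iff by blast
  moreover have "realization K = top_of_set points"
    by (simp add: realization_def)
  moreover obtain F where "continuous_map (top_of_set (points_over L)) Y F"
    "\<forall>g\<in>carrier G. \<forall>x\<in>points_over L. F (act g x) = \<beta> g (F x)"
    using L unfolding good_def by blast
  ultimately show ?thesis
    using that[of F] unfolding \<open>L = K\<close> by simp
qed

end

section \<open>Maps defined on the barycentric subdivision\<close>

text \<open>
  A continuous substitute for barycentric coordinates in the first barycentric subdivision. The
  weight of \<open>\<sigma>\<close> at \<open>x\<close> is nonzero iff \<open>\<sigma>\<close> consists of the vertices whose
  coordinate exceeds some nonnegative threshold, so the simplices of nonzero weight form a chain.
\<close>

definition chain_weight :: "'a set \<Rightarrow> 'a set \<Rightarrow> ('a \<Rightarrow> real) \<Rightarrow> real" where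
  "chain_weight V \<sigma> x = (\<Prod>u\<in>\<sigma>. x u) * (\<Prod>u\<in>\<sigma>. \<Prod>v\<in>V - \<sigma>. max 0 (x u - x v))"

lemma chain_weight_nonneg: "(\<And>v. 0 \<le> x v) \<Longrightarrow> 0 \<le> chain_weight V \<sigma> x"
  unfolding chain_weight_def by (intro mult_nonneg_nonneg prod_nonneg) auto

lemma chain_weight_nonzero_iff:
  assumes "finite V" "\<sigma> \<subseteq> V"
  shows "chain_weight V \<sigma> x \<noteq> 0 \<longleftrightarrow> (\<forall>u\<in>\<sigma>. x u \<noteq> 0) \<and> (\<forall>u\<in>\<sigma>. \<forall>v\<in>V - \<sigma>. x v < x u)"
proof -
  have fin: "finite \<sigma>" "finite (V - \<sigma>)"
    using assms finite_subset by auto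
  have "max 0 (x u - x v) \<noteq> 0 \<longleftrightarrow> x v < x u" for u v
    by auto
  then show ?thesis
    unfolding chain_weight_def mult_eq_0_iff prod_zero_iff[OF fin(1)] prod_zero_iff[OF fin(2)]
    by blast
qed

lemma continuous_on_chain_weight: "continuous_on S (chain_weight V \<sigma>)"
  unfolding chain_weight_def
  by (intro continuous_on_mult continuous_on_prod continuous_on_max continuous_on_diff
      continuous_on_const continuous_on_coordinate)

lemma chain_weight_image:
  assumes f: "bij_betw f V V" "\<sigma> \<subseteq> V" and xy: "\<And>v. v \<in> V \<Longrightarrow> y (f v) = x v"
  shows "chain_weight V (f ` \<sigma>) y = chain_weight V \<sigma> x"
proof -
  have inj: "inj_on f \<sigma>" "inj_on f (V - \<sigma>)"
    using f by (auto simp: bij_betw_def intro: inj_on_subset)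
  have diff: "V - f ` \<sigma> = f ` (V - \<sigma>)"
    using f by (metis bij_betw_def inj_on_image_set_diff Diff_subset)
  have "(\<Prod>u\<in>f ` \<sigma>. y u) = (\<Prod>u\<in>\<sigma>. x u)"
    using f(2) by (auto simp: prod.reindex[OF inj(1)] xy intro!: prod.cong)
  moreover have "(\<Prod>u\<in>f ` \<sigma>. \<Prod>v\<in>V - f ` \<sigma>. max 0 (y u - y v))
      = (\<Prod>u\<in>\<sigma>. \<Prod>v\<in>V - \<sigma>. max 0 (x u - x v))"
    unfolding diff using f(2)
    by (auto simp: prod.reindex[OF inj(1)] prod.reindex[OF inj(2)] xy intro!: prod.cong)
  ultimately show ?thesis
    by (simp add: chain_weight_def)
qed

lemma (in simplicial_action) realization_eq_top_of_set: "top_of_set points = realization K"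
  by (simp add: realization_def)

text \<open>
  The hypotheses say that \<open>\<Gamma>\<close> is an equivariant simplicial map from the barycentric subdivision of
  \<open>K\<close> to \<open>L\<close>. Its affine extension, in terms of the normalised chain weights, is the required map.
\<close>

lemma (in simplicial_action) equivariant_map_of_barycentric_map:
  fixes L :: "'b set set"
  assumes L: "simplicial_action G L \<psi>"
    and chain: "\<And>S. S \<subseteq> K \<Longrightarrow> S \<noteq> {} \<Longrightarrow> (\<And>\<sigma> \<tau>. \<sigma> \<in> S \<Longrightarrow> \<tau> \<in> S \<Longrightarrow> \<sigma> \<subseteq> \<tau> \<or> \<tau> \<subseteq> \<sigma>) \<Longrightarrow> \<Gamma> ` S \<in> L"
    and equiv: "\<And>g \<sigma>. g \<in> carrier G \<Longrightarrow> \<sigma> \<in> K \<Longrightarrow> \<Gamma> (\<phi> g ` \<sigma>) = \<psi> g (\<Gamma> \<sigma>)"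
  obtains f where "continuous_map (realization K) (realization L) f"
    "\<And>g x. g \<in> carrier G \<Longrightarrow> x \<in> points \<Longrightarrow> f (act g x) = realization_map L (\<psi> g) (f x)"
proof -
  interpret L: simplicial_action G L \<psi> by fact
  define \<mu> where "\<mu> = chain_weight (vertex_set K)"
  define N where "N x = (\<Sum>\<sigma>\<in>K. \<mu> \<sigma> x)" for x
  define f where "f x w = (\<Sum>\<sigma>\<in>{\<sigma> \<in> K. \<Gamma> \<sigma> = w}. \<mu> \<sigma> x / N x)" for x w
  have finK: "finite K"
    using complex unfolding abstract_complex_def by blast
  have \<Gamma>_vertex: "\<Gamma> \<sigma> \<in> vertex_set L" if "\<sigma> \<in> K" for \<sigma>
  proof -
    have "\<Gamma> ` {\<sigma>} \<in> L"
      using that by (intro chain) auto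
    then show ?thesis
      using L.simplex_subset by blast
  qed
  have nonneg: "0 \<le> \<mu> \<sigma> x" if "x \<in> points" for \<sigma> x
    using that chain_weight_nonneg unfolding \<mu>_def points_iff by blast
  have nonzero: "\<mu> \<sigma> x \<noteq> 0 \<longleftrightarrow> (\<forall>u\<in>\<sigma>. x u \<noteq> 0) \<and> (\<forall>u\<in>\<sigma>. \<forall>v\<in>vertex_set K - \<sigma>. x v < x u)"
    if "\<sigma> \<in> K" for \<sigma> x
    unfolding \<mu>_def by (rule chain_weight_nonzero_iff[OF finite_vertex_set simplex_subset[OF that]])
  \<comment> \<open>The vertices of largest coordinate form a face of positive weight.\<close>
  have top_face: "\<exists>\<sigma>\<in>K. \<mu> \<sigma> x \<noteq> 0" if x: "x \<in> points" for x
  proof -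
    let ?V = "vertex_set K"
    have supp: "{v. x v \<noteq> 0} \<in> K"
      using x unfolding points_iff by blast
    then obtain u where u: "x u \<noteq> 0"
      using simplex_nonempty by blast
    have uV: "u \<in> ?V"
      using u point_outside[OF x] by blast
    define \<sigma> where "\<sigma> = {v \<in> ?V. x v = Max (x ` ?V)}"
    have le: "x v \<le> Max (x ` ?V)" if "v \<in> ?V" for v
      using that finite_vertex_set by simp
    have "0 \<le> x u"
      using x unfolding points_iff by blast
    with u le[OF uV] have pos: "0 < Max (x ` ?V)"
      by linarith
    have "Max (x ` ?V) \<in> x ` ?V"
      using finite_vertex_set uV by (intro Max_in) auto
    then have "\<sigma> \<noteq> {}"
      unfolding \<sigma>_def by force
    moreover have "\<sigma> \<subseteq> {v. x v \<noteq> 0}"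
      using pos unfolding \<sigma>_def by auto
    ultimately have "\<sigma> \<in> K"
      using face_closed[OF supp] by blast
    moreover have "x v < x w" if "w \<in> \<sigma>" "v \<in> ?V - \<sigma>" for v w
      using that le[of v] unfolding \<sigma>_def by fastforce
    moreover have "x w \<noteq> 0" if "w \<in> \<sigma>" for w
      using that pos unfolding \<sigma>_def by simp
    ultimately show ?thesis
      using nonzero by blast
  qed
  have N_pos: "N x > 0" if x: "x \<in> points" for x
  proof -
    obtain \<sigma> where "\<sigma> \<in> K" "\<mu> \<sigma> x \<noteq> 0"
      using top_face[OF x] by blast
    then have "0 < \<mu> \<sigma> x"
      using nonneg[OF x, of \<sigma>] by simp
    then show ?thesis
      unfolding N_def using \<open>\<sigma> \<in> K\<close> nonneg[OF x] finK by (intro sum_pos2[of K \<sigma>]) auto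
  qed
  have f_points: "f x \<in> L.points" if x: "x \<in> points" for x
  proof -
    define S where "S = {\<sigma> \<in> K. \<mu> \<sigma> x \<noteq> 0}"
    have "\<Gamma> ` S \<in> L"
    proof (rule chain)
      show "S \<subseteq> K" "S \<noteq> {}"
        using top_face[OF x] by (auto simp: S_def)
      show "\<sigma> \<subseteq> \<tau> \<or> \<tau> \<subseteq> \<sigma>" if "\<sigma> \<in> S" "\<tau> \<in> S" for \<sigma> \<tau>
      proof (rule ccontr)
        assume "\<not> (\<sigma> \<subseteq> \<tau> \<or> \<tau> \<subseteq> \<sigma>)"
        then obtain u v where uv: "u \<in> \<sigma>" "u \<notin> \<tau>" "v \<in> \<tau>" "v \<notin> \<sigma>"
          by blast
        moreover have "\<sigma> \<in> K" "\<tau> \<in> K"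
          using that by (auto simp: S_def)
        moreover from this uv have "u \<in> vertex_set K" "v \<in> vertex_set K"
          using simplex_subset by blast+
        ultimately have "x v < x u" "x u < x v"
          using that nonzero[of \<sigma> x] nonzero[of \<tau> x] unfolding S_def by blast+
        then show False
          by simp
      qed
    qed
    moreover have "{w. f x w \<noteq> 0} = \<Gamma> ` S"
    proof -
      have "f x w = 0 \<longleftrightarrow> (\<forall>\<sigma>\<in>{\<sigma> \<in> K. \<Gamma> \<sigma> = w}. \<mu> \<sigma> x / N x = 0)" for w
        unfolding f_def using finK nonneg[OF x] N_pos[OF x]
        by (intro sum_nonneg_eq_0_iff) (auto intro: divide_nonneg_pos)
      then have "f x w \<noteq> 0 \<longleftrightarrow> (\<exists>\<sigma>\<in>S. \<Gamma> \<sigma> = w)" for w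
        using N_pos[OF x] unfolding S_def by auto
      then show ?thesis
        by auto
    qed
    moreover have "0 \<le> f x w" for w
      unfolding f_def using nonneg[OF x] N_pos[OF x] by (intro sum_nonneg divide_nonneg_pos) auto
    moreover have "sum (f x) (vertex_set L) = 1"
    proof -
      have "sum (f x) (vertex_set L) = (\<Sum>\<sigma>\<in>K. \<mu> \<sigma> x / N x)"
        unfolding f_def using finK L.finite_vertex_set \<Gamma>_vertex by (intro sum.group) auto
      also have "\<dots> = 1"
        using N_pos[OF x] by (simp add: N_def flip: sum_divide_distrib)
      finally show ?thesis .
    qed
    ultimately show ?thesis
      unfolding L.points_iff by simp
  qed
  have \<mu>_image: "\<mu> (\<phi> g ` \<sigma>) (act g x) = \<mu> \<sigma> x" if "g \<in> carrier G" "\<sigma> \<in> K" for g \<sigma> x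
    unfolding \<mu>_def
    by (rule chain_weight_image)
      (simp_all add: that bij_betw_def inj_prop surj_prop simplex_subset act_at_image)
  have bij_K: "bij_betw ((`) (\<phi> g)) K K" if g: "g \<in> carrier G" for g
  proof -
    have inj: "inj_on ((`) (\<phi> g)) K"
      using inj_on_image_eq_iff[OF inj_prop[OF g]] simplex_subset by (intro inj_onI) blast
    moreover have "(`) (\<phi> g) ` K \<subseteq> K"
      using image_simplex[OF g] by blast
    ultimately show ?thesis
      unfolding bij_betw_def using endo_inj_surj finK by blast
  qed
  have N_act: "N (act g x) = N x" if g: "g \<in> carrier G" for g x
  proof -
    have "N (act g x) = (\<Sum>\<sigma>\<in>K. \<mu> (\<phi> g ` \<sigma>) (act g x))"
      unfolding N_def by (rule sum.reindex_bij_betw[OF bij_K[OF g], symmetric])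
    also have "\<dots> = N x"
      unfolding N_def using \<mu>_image[OF g] by (intro sum.cong refl)
    finally show ?thesis .
  qed
  have "f (act g x) = L.act g (f x)" if g: "g \<in> carrier G" and x: "x \<in> points" for g x
  proof (rule L.act_eqI[OF g, symmetric])
    show "f (act g x) w = 0" if "w \<notin> vertex_set L" for w
    proof -
      have "{\<sigma> \<in> K. \<Gamma> \<sigma> = w} = {}"
        using that \<Gamma>_vertex by blast
      then show ?thesis
        unfolding f_def by (simp only: sum.empty)
    qed
    show "f (act g x) (\<psi> g w) = f x w" if w: "w \<in> vertex_set L" for w
    proof -
      have "\<psi> g (\<Gamma> \<sigma>) = \<psi> g w \<longleftrightarrow> \<Gamma> \<sigma> = w" if "\<sigma> \<in> K" for \<sigma>
        using inj_on_eq_iff[OF L.inj_prop[OF g] \<Gamma>_vertex[OF that] w] .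
      then have iff: "\<Gamma> (\<phi> g ` \<sigma>) = \<psi> g w \<longleftrightarrow> \<Gamma> \<sigma> = w" if "\<sigma> \<in> K" for \<sigma>
        using that equiv[OF g] by simp
      have "bij_betw ((`) (\<phi> g)) {\<sigma> \<in> K. \<Gamma> \<sigma> = w} {\<sigma> \<in> K. \<Gamma> \<sigma> = \<psi> g w}"
        using bij_K[OF g] by (rule bij_betw_Collect) (use iff in simp)
      then have "f (act g x) (\<psi> g w)
          = (\<Sum>\<sigma>\<in>{\<sigma> \<in> K. \<Gamma> \<sigma> = w}. \<mu> (\<phi> g ` \<sigma>) (act g x) / N (act g x))"
        unfolding f_def by (rule sum.reindex_bij_betw[symmetric])
      also have "\<dots> = f x w"
        unfolding f_def N_act[OF g] using \<mu>_image[OF g] by (intro sum.cong) auto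
      finally show ?thesis .
    qed
  qed
  moreover have "continuous_map (realization K) (realization L) f"
  proof -
    have "continuous_on points N"
      unfolding N_def \<mu>_def by (intro continuous_on_sum continuous_on_chain_weight)
    moreover have "\<forall>x\<in>points. N x \<noteq> 0"
      by (intro ballI) (rule less_imp_neq[OF N_pos, symmetric])
    ultimately have "continuous_on points (\<lambda>x. f x w)" for w
      unfolding f_def \<mu>_def
      by (intro continuous_on_sum continuous_on_divide continuous_on_chain_weight)
    then have "continuous_on points f"
      by (rule continuous_on_coordinatewise_then_product)
    then have "continuous_map (top_of_set points) (top_of_set L.points) f"
      using f_points by auto
    then show ?thesis
      by (simp only: realization_eq_top_of_set L.realization_eq_top_of_set)
  qed
  ultimately show ?thesis
    using that by blast
qed

section \<open>Equivariant choice of signs\<close>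

text \<open>
  Choose a representative in each orbit; by freeness each \<open>x\<close> is the translate of its
  representative by exactly one group element, and this element is \<open>s x\<close>.
\<close>

lemma (in group) free_action_section:
  assumes closed: "\<And>g x. g \<in> carrier G \<Longrightarrow> x \<in> X \<Longrightarrow> \<rho> g x \<in> X"
    and one: "\<And>x. x \<in> X \<Longrightarrow> \<rho> \<one> x = x"
    and mult: "\<And>g h x. g \<in> carrier G \<Longrightarrow> h \<in> carrier G \<Longrightarrow> x \<in> X \<Longrightarrow> \<rho> (g \<otimes> h) x = \<rho> g (\<rho> h x)"
    and free: "\<And>g x. g \<in> carrier G \<Longrightarrow> x \<in> X \<Longrightarrow> \<rho> g x = x \<Longrightarrow> g = \<one>"
  obtains s where "\<And>x. x \<in> X \<Longrightarrow> s x \<in> carrier G"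
    "\<And>g x. g \<in> carrier G \<Longrightarrow> x \<in> X \<Longrightarrow> s (\<rho> g x) = g \<otimes> s x"
proof -
  define orb where "orb x = (\<lambda>g. \<rho> g x) ` carrier G" for x
  define rep where "rep x = (SOME y. y \<in> orb x)" for x
  define s where "s x = (SOME g. g \<in> carrier G \<and> \<rho> g (rep x) = x)" for x
  have inv_back: "\<rho> (inv g) (\<rho> g x) = x" if "g \<in> carrier G" "x \<in> X" for g x
    using that mult[of "inv g" g x] one by simp
  have rep_orb: "rep x \<in> orb x" for x
    unfolding rep_def by (rule someI[of _ "\<rho> \<one> x"]) (auto simp: orb_def)
  have s: "s x \<in> carrier G \<and> \<rho> (s x) (rep x) = x" if x: "x \<in> X" for x
  proof -
    obtain g where "g \<in> carrier G" "rep x = \<rho> g x"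
      using rep_orb[of x] unfolding orb_def by blast
    then have "inv g \<in> carrier G \<and> \<rho> (inv g) (rep x) = x"
      using inv_back x by simp
    then show ?thesis
      unfolding s_def by (rule someI)
  qed
  have orb_eq: "orb (\<rho> g x) = orb x" if g: "g \<in> carrier G" and x: "x \<in> X" for g x
  proof (intro equalityI subsetI)
    fix y assume "y \<in> orb (\<rho> g x)"
    then obtain h where "h \<in> carrier G" "y = \<rho> (h \<otimes> g) x"
      using mult g x unfolding orb_def by auto
    then show "y \<in> orb x"
      using g unfolding orb_def by blast
  next
    fix y assume "y \<in> orb x"
    then obtain h where h: "h \<in> carrier G" "y = \<rho> h x"
      unfolding orb_def by blast
    have "\<rho> (h \<otimes> inv g) (\<rho> g x) = \<rho> h (\<rho> (inv g) (\<rho> g x))"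
      using g h x closed by (intro mult) auto
    then have "y = \<rho> (h \<otimes> inv g) (\<rho> g x)"
      using h inv_back[OF g x] by simp
    then show "y \<in> orb (\<rho> g x)"
      using g h unfolding orb_def by blast
  qed
  have "s (\<rho> g x) = g \<otimes> s x" if g: "g \<in> carrier G" and x: "x \<in> X" for g x
  proof -
    let ?y = "rep x" and ?k = "s (\<rho> g x)"
    have "rep (\<rho> g x) = ?y"
      using orb_eq[OF g x] by (simp add: rep_def)
    then have k: "?k \<in> carrier G" "\<rho> ?k ?y = \<rho> g x"
      using s[OF closed[OF g x]] by auto
    have sx: "s x \<in> carrier G" "\<rho> (s x) ?y = x"
      using s[OF x] by auto
    obtain h where "h \<in> carrier G" "?y = \<rho> h x"
      using rep_orb[of x] unfolding orb_def by blast
    then have y: "?y \<in> X"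
      using closed x by simp
    have "\<rho> (inv ?k) (\<rho> (g \<otimes> s x) ?y) = ?y"
      using mult[OF g sx(1) y] sx k(2) inv_back[OF k(1) y] by simp
    then have "\<rho> (inv ?k \<otimes> (g \<otimes> s x)) ?y = ?y"
      using k(1) g sx(1) y by (subst mult) auto
    then have "inv ?k \<otimes> (g \<otimes> s x) = \<one>"
      using k(1) g sx(1) y by (intro free) auto
    then show ?thesis
      using k(1) g sx(1) inv_solve_left'[of \<one> ?k "g \<otimes> s x"] by simp
  qed
  with s that show ?thesis
    by blast
qed

text \<open>
  The same rule as \<open>join_action\<close>, but not cut off to finitely many layers, so that it also acts on
  subsets of the layer \<open>0\<close>, where sets of signs are placed below.
\<close>

definition translate :: "nat \<Rightarrow> int \<Rightarrow> int \<times> nat \<Rightarrow> int \<times> nat" where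
  "translate p g = (\<lambda>(e, j). ((g + e) mod int p, j))"

lemma Zp_mem_iff: "p > 0 \<Longrightarrow> e \<in> carrier (Zp p) \<longleftrightarrow> 0 \<le> e \<and> e < int p"
  by (simp add: carrier_integer_mod_group)

lemma add_mod_cancel:
  assumes "p > 0" "e \<in> carrier (Zp p)" "e' \<in> carrier (Zp p)" "(g + e) mod int p = (g + e') mod int p"
  shows "e = e'"
proof -
  have "e mod int p = e' mod int p"
    using assms(4) by (metis add_diff_cancel_left' mod_diff_left_eq)
  then show ?thesis
    using assms by (simp add: Zp_mem_iff)
qed

lemma inj_on_translate:
  assumes "p > 0" "\<tau> \<subseteq> carrier (Zp p) \<times> UNIV"
  shows "inj_on (translate p g) \<tau>"
proof (rule inj_onI)
  fix x y assume "x \<in> \<tau>" "y \<in> \<tau>" "translate p g x = translate p g y"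
  then show "x = y"
    using assms add_mod_cancel[OF assms(1), of "fst x" "fst y" g]
    by (auto simp: translate_def split: prod.splits)
qed

lemma translate_mult: "p > 0 \<Longrightarrow> translate p (g \<otimes>\<^bsub>Zp p\<^esub> h) x = translate p g (translate p h x)"
  by (auto simp: translate_def mod_simps algebra_simps split: prod.splits)

lemma translate_one: "p > 0 \<Longrightarrow> x \<in> carrier (Zp p) \<times> UNIV \<Longrightarrow> translate p 0 x = x"
  by (auto simp: translate_def Zp_mem_iff)

lemma mod_in_Zp: "p > 0 \<Longrightarrow> a mod int p \<in> carrier (Zp p)"
  by (simp add: Zp_mem_iff)

definition proper_column :: "nat \<Rightarrow> (int \<times> nat) set \<Rightarrow> bool" where
  "proper_column p \<kappa> \<longleftrightarrow>
     (\<exists>j. \<exists>e\<in>carrier (Zp p). \<exists>e'\<in>carrier (Zp p). (e, j) \<in> \<kappa> \<and> (e', j) \<notin> \<kappa>)"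

text \<open>
  A layer that is invariant under a nonzero \<open>g\<close> is invariant under the whole group, since \<open>g\<close>
  generates the group of prime order; so it is empty or full.
\<close>

lemma translate_free:
  assumes p: "prime p" and g: "g \<in> carrier (Zp p)" and \<kappa>: "proper_column p \<kappa>"
    and fixed: "translate p g ` \<kappa> = \<kappa>"
  shows "g = 0"
proof (rule ccontr)
  assume "g \<noteq> 0"
  have p0: "p > 0"
    using p prime_gt_0_nat by blast
  obtain j e e' where e: "e \<in> carrier (Zp p)" "e' \<in> carrier (Zp p)" "(e, j) \<in> \<kappa>" "(e', j) \<notin> \<kappa>"
    using \<kappa> unfolding proper_column_def by blast
  have step: "((g + a) mod int p, j) \<in> \<kappa>" if "(a, j) \<in> \<kappa>" for a
    using fixed that by (force simp: translate_def)
  have orbit: "((e + int k * g) mod int p, j) \<in> \<kappa>" for k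
  proof (induction k)
    case 0
    then show ?case
      using e p0 by (simp add: Zp_mem_iff)
  next
    case (Suc k)
    from step[OF this] show ?case
      by (simp add: mod_simps algebra_simps)
  qed
  have "\<not> int p dvd g"
    using g \<open>g \<noteq> 0\<close> p0 zdvd_not_zless[of g "int p"] by (auto simp: Zp_mem_iff)
  then have "coprime g (int p)"
    using p by (metis coprime_commute prime_imp_coprime prime_nat_int_transfer)
  then obtain x where x: "[g * x = 1] (mod int p)"
    using cong_solve_coprime_int by blast
  define k where "k = nat ((x * (e' - e)) mod int p)"
  have k: "int k = (x * (e' - e)) mod int p"
    using p0 by (simp add: k_def)
  have "[e + int k * g = e + x * (e' - e) * g] (mod int p)"
    unfolding k by (intro cong_add cong_refl cong_scalar_right) simp
  also have "e + x * (e' - e) * g = e + (g * x) * (e' - e)"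
    by (simp add: algebra_simps)
  also have "[e + (g * x) * (e' - e) = e + 1 * (e' - e)] (mod int p)"
    using x by (intro cong_add cong_mult cong_refl)
  finally have "(e + int k * g) mod int p = e'"
    using e p0 by (simp add: cong_def Zp_mem_iff)
  then show False
    using orbit[of k] e by simp
qed

text \<open>
  A set with a layer that is neither empty nor full is moved by every nonzero group element, so its
  translates can be told apart by a sign that is translated along with them.
\<close>

lemma equivariant_sign:
  assumes p: "prime p"
  obtains s where
    "\<And>\<kappa>. \<kappa> \<subseteq> carrier (Zp p) \<times> UNIV \<Longrightarrow> proper_column p \<kappa> \<Longrightarrow> s \<kappa> \<in> carrier (Zp p)"
    "\<And>g \<kappa>. g \<in> carrier (Zp p) \<Longrightarrow> \<kappa> \<subseteq> carrier (Zp p) \<times> UNIV \<Longrightarrow> proper_column p \<kappa> \<Longrightarrow>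
      s (translate p g ` \<kappa>) = g \<otimes>\<^bsub>Zp p\<^esub> s \<kappa>"
proof -
  have p0: "p > 0"
    using p prime_gt_0_nat by blast
  interpret group "Zp p" by simp
  define X where "X = {\<kappa>. \<kappa> \<subseteq> carrier (Zp p) \<times> (UNIV :: nat set) \<and> proper_column p \<kappa>}"
  have closed: "translate p g ` \<kappa> \<in> X" if \<kappa>: "\<kappa> \<in> X" for g \<kappa>
  proof -
    obtain j e e' where e: "e \<in> carrier (Zp p)" "e' \<in> carrier (Zp p)" "(e, j) \<in> \<kappa>" "(e', j) \<notin> \<kappa>"
      using \<kappa> unfolding X_def proper_column_def by blast
    have "((g + e) mod int p, j) \<in> translate p g ` \<kappa>"
      using e(3) by (force simp: translate_def)
    moreover have "((g + e') mod int p, j) \<notin> translate p g ` \<kappa>"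
    proof
      assume "((g + e') mod int p, j) \<in> translate p g ` \<kappa>"
      then obtain a where a: "(a, j) \<in> \<kappa>" "(g + a) mod int p = (g + e') mod int p"
        by (auto simp: translate_def)
      have "a \<in> carrier (Zp p)"
        using a(1) \<kappa> unfolding X_def by blast
      then have "a = e'"
        using e(2) a(2) by (rule add_mod_cancel[OF p0])
      with a e show False by simp
    qed
    ultimately have "proper_column p (translate p g ` \<kappa>)"
      using mod_in_Zp[OF p0] unfolding proper_column_def by blast
    moreover have "translate p g ` \<kappa> \<subseteq> carrier (Zp p) \<times> UNIV"
      using mod_in_Zp[OF p0] by (auto simp: translate_def)
    ultimately show ?thesis
      by (simp add: X_def)
  qed
  obtain s where "\<And>\<kappa>. \<kappa> \<in> X \<Longrightarrow> s \<kappa> \<in> carrier (Zp p)"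
    "\<And>g \<kappa>. g \<in> carrier (Zp p) \<Longrightarrow> \<kappa> \<in> X \<Longrightarrow> s (translate p g ` \<kappa>) = g \<otimes>\<^bsub>Zp p\<^esub> s \<kappa>"
  proof (rule free_action_section[of X "\<lambda>g \<kappa>. translate p g ` \<kappa>"])
    show "translate p \<one>\<^bsub>Zp p\<^esub> ` \<kappa> = \<kappa>" if "\<kappa> \<in> X" for \<kappa>
    proof -
      have "translate p 0 x = x" if "x \<in> \<kappa>" for x
        using \<open>\<kappa> \<in> X\<close> that by (intro translate_one[OF p0]) (auto simp: X_def)
      then show ?thesis
        by simp
    qed
    show "translate p (g \<otimes>\<^bsub>Zp p\<^esub> h) ` \<kappa> = translate p g ` translate p h ` \<kappa>" for g h \<kappa>
      unfolding image_image translate_mult[OF p0] ..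
    show "g = \<one>\<^bsub>Zp p\<^esub>" if "g \<in> carrier (Zp p)" "\<kappa> \<in> X" "translate p g ` \<kappa> = \<kappa>" for g \<kappa>
      using translate_free[OF p, of g \<kappa>] that by (simp add: X_def)
  next
    show "translate p g ` \<kappa> \<in> X" if "\<kappa> \<in> X" for g \<kappa>
      using closed[OF that] .
  qed blast
  note sign = this
  show ?thesis
    by (rule that[of s]) (simp_all add: sign X_def del: mult_integer_mod_group)
qed

section \<open>Levels of simplices of the join\<close>

definition min_count :: "nat \<Rightarrow> (int \<times> nat) set \<Rightarrow> nat" where
  "min_count p \<tau> = Min ((\<lambda>e. card (sign_part \<tau> e)) ` carrier (Zp p))"

definition excess :: "nat \<Rightarrow> (int \<times> nat) set \<Rightarrow> int set" where
  "excess p \<tau> = {e \<in> carrier (Zp p). min_count p \<tau> < card (sign_part \<tau> e)}"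

text \<open>The largest size of a subset of \<open>\<tau>\<close> whose sign parts differ in size by at most one.\<close>

definition level :: "nat \<Rightarrow> (int \<times> nat) set \<Rightarrow> nat" where
  "level p \<tau> = p * min_count p \<tau> + card (excess p \<tau>)"

text \<open>
  The part of \<open>\<tau>\<close> on which the choice of its sign is based. It must be constant along chains of
  constant level, and the group must act freely on its values. The set of signs in excess does this
  unless it is empty; then \<open>\<tau>\<close> itself does. The layer \<open>0\<close>, which a simplex of the join never
  meets, turns a set of signs into a set of the same type as \<open>\<tau>\<close>.
\<close>

definition pattern :: "nat \<Rightarrow> (int \<times> nat) set \<Rightarrow> (int \<times> nat) set" where
  "pattern p \<tau> = (if excess p \<tau> = {} then \<tau> else excess p \<tau> \<times> {0})"

lemma finite_Zp: "p > 0 \<Longrightarrow> finite (carrier (Zp p))"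
  by (simp add: carrier_integer_mod_group)

lemma card_Zp: "p > 0 \<Longrightarrow> card (carrier (Zp p)) = p"
  by (simp add: carrier_integer_mod_group)

lemma Zp_nonempty: "carrier (Zp p) \<noteq> {}"
  using integer_mod_group_0 by blast

lemma min_count_le: "p > 0 \<Longrightarrow> e \<in> carrier (Zp p) \<Longrightarrow> min_count p \<tau> \<le> card (sign_part \<tau> e)"
  by (simp add: min_count_def finite_Zp)

lemma min_count_attained: "p > 0 \<Longrightarrow> \<exists>e\<in>carrier (Zp p). card (sign_part \<tau> e) = min_count p \<tau>"
proof -
  assume "p > 0"
  then have "min_count p \<tau> \<in> (\<lambda>e. card (sign_part \<tau> e)) ` carrier (Zp p)"
    unfolding min_count_def using finite_Zp Zp_nonempty by (intro Min_in) auto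
  then show ?thesis by auto
qed

lemma card_excess_less:
  assumes "p > 0" shows "card (excess p \<tau>) < p"
proof -
  obtain e where "e \<in> carrier (Zp p)" "e \<notin> excess p \<tau>"
    using min_count_attained[OF assms, of \<tau>] by (auto simp: excess_def)
  then have "excess p \<tau> \<subset> carrier (Zp p)"
    by (auto simp: excess_def)
  then show ?thesis
    using psubset_card_mono[OF finite_Zp[OF assms]] card_Zp[OF assms] by metis
qed

lemma finite_sign_part: "finite \<tau> \<Longrightarrow> finite (sign_part \<tau> e)"
  by (rule finite_subset[of _ \<tau>]) (auto simp: sign_part_def)

lemma sign_part_mono: "\<tau> \<subseteq> \<tau>' \<Longrightarrow> sign_part \<tau> e \<subseteq> sign_part \<tau>' e"
  by (auto simp: sign_part_def)

lemma card_sign_part_mono: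
  "finite \<tau>' \<Longrightarrow> \<tau> \<subseteq> \<tau>' \<Longrightarrow> card (sign_part \<tau> e) \<le> card (sign_part \<tau>' e)"
  by (intro card_mono finite_sign_part sign_part_mono)

text \<open>
  The minimum and the number of signs in excess are quotient and remainder of the level modulo
  \<open>p\<close>, so both are the same for \<open>\<tau>\<close> and \<open>\<tau>'\<close>, and the sets in excess, being nested, are equal. If
  they are empty, all sign parts of \<open>\<tau>\<close> and \<open>\<tau>'\<close> have the same size, which forces \<open>\<tau> = \<tau>'\<close>.
\<close>

lemma pattern_eq_of_level_eq:
  assumes p: "p > 0" and fin: "finite \<tau>'" and sub: "\<tau> \<subseteq> \<tau>'" "\<tau>' \<subseteq> carrier (Zp p) \<times> UNIV"
    and lev: "level p \<tau> = level p \<tau>'"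
  shows "pattern p \<tau> = pattern p \<tau>'"
proof -
  have "level p \<tau> div p = min_count p \<tau>" "level p \<tau> mod p = card (excess p \<tau>)" for \<tau>
    using card_excess_less[OF p] p by (simp_all add: level_def)
  then have h: "min_count p \<tau> = min_count p \<tau>'" and a: "card (excess p \<tau>) = card (excess p \<tau>')"
    using lev by metis+
  have "excess p \<tau> \<subseteq> excess p \<tau>'"
    using h card_sign_part_mono[OF fin sub(1)] by (auto simp: excess_def intro: less_le_trans)
  moreover have "finite (excess p \<tau>')"
    using finite_Zp[OF p] by (simp add: excess_def)
  ultimately have A: "excess p \<tau> = excess p \<tau>'"
    using a by (intro card_subset_eq)
  show ?thesis
  proof (cases "excess p \<tau> = {}")
    case True
    have "sign_part \<tau> e = sign_part \<tau>' e" if e: "e \<in> carrier (Zp p)" for e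
    proof (rule card_subset_eq[OF finite_sign_part[OF fin] sign_part_mono[OF sub(1)]])
      have "e \<notin> excess p \<tau>" "e \<notin> excess p \<tau>'"
        using True A by auto
      then have "card (sign_part \<tau> e) = min_count p \<tau>" "card (sign_part \<tau>' e) = min_count p \<tau>'"
        using e min_count_le[OF p e] by (auto simp: excess_def intro: antisym)
      then show "card (sign_part \<tau> e) = card (sign_part \<tau>' e)"
        using h by simp
    qed
    then have "\<tau>' \<subseteq> \<tau>"
      using sub(2) by (auto simp: sign_part_def set_eq_iff)
    then show ?thesis
      using sub(1) by simp
  qed (simp add: pattern_def A)
qed

lemma level_pos:
  assumes p: "p > 0" and fin: "finite \<tau>" and \<tau>: "\<tau> \<noteq> {}" "\<tau> \<subseteq> carrier (Zp p) \<times> UNIV"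
  shows "level p \<tau> > 0"
proof (rule ccontr)
  assume "\<not> level p \<tau> > 0"
  then have h: "min_count p \<tau> = 0" and "card (excess p \<tau>) = 0"
    using p by (auto simp: level_def)
  then have "excess p \<tau> = {}"
    using finite_Zp[OF p] by (simp add: excess_def)
  moreover obtain e j where "(e, j) \<in> \<tau>"
    using \<tau>(1) by auto
  moreover from this have "card (sign_part \<tau> e) > 0"
    using finite_sign_part[OF fin] by (auto simp: card_gt_0_iff sign_part_def)
  ultimately show False
    using h \<tau>(2) by (auto simp: excess_def)
qed

lemma card_sign_part_translate:
  assumes p: "p > 0" and \<tau>: "\<tau> \<subseteq> carrier (Zp p) \<times> UNIV" and e: "e \<in> carrier (Zp p)"
  shows "card (sign_part (translate p g ` \<tau>) ((g + e) mod int p)) = card (sign_part \<tau> e)"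
proof -
  have "sign_part (translate p g ` \<tau>) ((g + e) mod int p) = translate p g ` sign_part \<tau> e"
  proof (intro equalityI subsetI)
    fix x assume "x \<in> sign_part (translate p g ` \<tau>) ((g + e) mod int p)"
    then obtain a j where a: "(a, j) \<in> \<tau>" "x = ((g + a) mod int p, j)"
        "(g + a) mod int p = (g + e) mod int p"
      by (auto simp: sign_part_def translate_def)
    have "a \<in> carrier (Zp p)"
      using a(1) \<tau> by blast
    then have "a = e"
      using e a(3) by (rule add_mod_cancel[OF p])
    with a show "x \<in> translate p g ` sign_part \<tau> e"
      by (force simp: sign_part_def translate_def)
  qed (auto simp: sign_part_def translate_def)
  moreover have "inj_on (translate p g) (sign_part \<tau> e)"
    by (rule inj_on_subset[OF inj_on_translate[OF p \<tau>]]) (auto simp: sign_part_def)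
  ultimately show ?thesis
    by (simp add: card_image)
qed

lemma Zp_translate:
  assumes p: "p > 0"
  shows "(\<lambda>e. (g + e) mod int p) ` carrier (Zp p) = carrier (Zp p)"
proof (rule endo_inj_surj[OF finite_Zp[OF p]])
  show "(\<lambda>e. (g + e) mod int p) ` carrier (Zp p) \<subseteq> carrier (Zp p)"
    using mod_in_Zp[OF p] by blast
  show "inj_on (\<lambda>e. (g + e) mod int p) (carrier (Zp p))"
    by (rule inj_onI) (rule add_mod_cancel[OF p])
qed

lemma min_count_translate:
  assumes p: "p > 0" and \<tau>: "\<tau> \<subseteq> carrier (Zp p) \<times> UNIV"
  shows "min_count p (translate p g ` \<tau>) = min_count p \<tau>"
proof -
  have "(\<lambda>e. card (sign_part (translate p g ` \<tau>) e)) ` carrier (Zp p)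
      = (\<lambda>e. card (sign_part (translate p g ` \<tau>) e)) ` (\<lambda>e. (g + e) mod int p) ` carrier (Zp p)"
    by (simp only: Zp_translate[OF p])
  also have "\<dots> = (\<lambda>e. card (sign_part \<tau> e)) ` carrier (Zp p)"
    unfolding image_image by (rule image_cong[OF refl card_sign_part_translate[OF p \<tau>]])
  finally show ?thesis
    by (simp add: min_count_def)
qed

lemma excess_translate:
  assumes p: "p > 0" and \<tau>: "\<tau> \<subseteq> carrier (Zp p) \<times> UNIV"
  shows "excess p (translate p g ` \<tau>) = (\<lambda>e. (g + e) mod int p) ` excess p \<tau>"
proof -
  have "excess p (translate p g ` \<tau>)
      = {e \<in> (\<lambda>e. (g + e) mod int p) ` carrier (Zp p).
          min_count p \<tau> < card (sign_part (translate p g ` \<tau>) e)}"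
    unfolding excess_def min_count_translate[OF p \<tau>] Zp_translate[OF p] ..
  also have "\<dots> = (\<lambda>e. (g + e) mod int p) ` {e \<in> carrier (Zp p).
          min_count p \<tau> < card (sign_part \<tau> e)}"
    using card_sign_part_translate[OF p \<tau>] by auto
  finally show ?thesis
    by (simp add: excess_def)
qed

lemma level_translate:
  assumes p: "p > 0" and \<tau>: "\<tau> \<subseteq> carrier (Zp p) \<times> UNIV"
  shows "level p (translate p g ` \<tau>) = level p \<tau>"
proof -
  have "inj_on (\<lambda>e. (g + e) mod int p) (excess p \<tau>)"
    by (rule inj_onI) (rule add_mod_cancel[OF p], auto simp: excess_def)
  then show ?thesis
    unfolding level_def min_count_translate[OF p \<tau>] excess_translate[OF p \<tau>] by (simp add: card_image)
qed

lemma pattern_translate: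
  assumes p: "p > 0" and \<tau>: "\<tau> \<subseteq> carrier (Zp p) \<times> UNIV"
  shows "pattern p (translate p g ` \<tau>) = translate p g ` pattern p \<tau>"
proof -
  have "(\<lambda>e. (g + e) mod int p) ` A \<times> {0} = translate p g ` (A \<times> {0})" for A
    by (force simp: translate_def)
  then show ?thesis
    by (simp add: pattern_def excess_translate[OF p \<tau>])
qed

lemma join_power_sigma_D:
  assumes p: "p > 0" and \<tau>: "\<tau> \<in> join_power (sigma_complex p) m"
  shows "\<tau> \<noteq> {}" "\<tau> \<subseteq> carrier (Zp p) \<times> {1..m}" "finite \<tau>" "proper_column p \<tau>"
proof -
  have \<tau>': "\<tau> \<noteq> {}" "\<tau> \<subseteq> vertex_set (sigma_complex p) \<times> {1..m}"
      "\<And>j. j \<in> {1..m} \<Longrightarrow> {v. (v, j) \<in> \<tau>} \<in> insert {} (sigma_complex p)"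
    using \<tau> unfolding join_power_def by blast+
  show "\<tau> \<noteq> {}" by fact
  have "vertex_set (sigma_complex p) \<subseteq> carrier (Zp p)"
    unfolding vertex_set_def sigma_complex_def by blast
  then show sub: "\<tau> \<subseteq> carrier (Zp p) \<times> {1..m}"
    using \<tau>'(2) by blast
  then show "finite \<tau>"
    using finite_Zp[OF p] by (meson finite_SigmaI finite_atLeastAtMost finite_subset)
  obtain e j where e: "(e, j) \<in> \<tau>"
    using \<open>\<tau> \<noteq> {}\<close> by auto
  then have "j \<in> {1..m}"
    using sub by blast
  then have "{v. (v, j) \<in> \<tau>} \<in> sigma_complex p"
    using \<tau>'(3)[of j] e by blast
  then obtain \<rho> where \<rho>: "\<rho> \<subseteq> carrier (Zp p)" "card \<rho> = p - 1" "{v. (v, j) \<in> \<tau>} \<subseteq> \<rho>"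
    unfolding sigma_complex_def by blast
  have "\<rho> \<noteq> carrier (Zp p)"
    using \<rho>(2) card_Zp[OF p] p by auto
  then obtain e' where "e' \<in> carrier (Zp p)" "e' \<notin> \<rho>"
    using \<rho>(1) by blast
  then show "proper_column p \<tau>"
    unfolding proper_column_def using e \<rho>(3) sub by blast
qed

lemma proper_column_pattern:
  assumes p: "p > 0" and \<tau>: "\<tau> \<in> join_power (sigma_complex p) m"
  shows "proper_column p (pattern p \<tau>)" "pattern p \<tau> \<subseteq> carrier (Zp p) \<times> UNIV"
proof -
  show "pattern p \<tau> \<subseteq> carrier (Zp p) \<times> UNIV"
    using join_power_sigma_D(2)[OF assms] by (auto simp: pattern_def excess_def)
  show "proper_column p (pattern p \<tau>)"
  proof (cases "excess p \<tau> = {}")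
    case True
    then show ?thesis
      using join_power_sigma_D(4)[OF assms] by (simp add: pattern_def)
  next
    case False
    then obtain e where "e \<in> excess p \<tau>" by blast
    moreover obtain e' where "e' \<in> carrier (Zp p)" "e' \<notin> excess p \<tau>"
      using min_count_attained[OF p, of \<tau>] by (auto simp: excess_def)
    ultimately show ?thesis
      using False by (auto simp: proper_column_def pattern_def excess_def)
  qed
qed

text \<open>
  Write \<open>n = p * q + r\<close> with \<open>r < p\<close>. Every sign occurs at least \<open>q\<close> times in \<open>\<tau>\<close> and at least
  \<open>r\<close> signs occur \<open>q + 1\<close> times; take \<open>q + 1\<close> vertices of \<open>r\<close> of these signs and \<open>q\<close> of the others.
\<close>

lemma balanced_subset_of_level:
  assumes p: "p > 0" and fin: "finite \<tau>" and \<tau>: "\<tau> \<subseteq> carrier (Zp p) \<times> UNIV"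
    and n: "n \<le> level p \<tau>"
  obtains S where "S \<subseteq> \<tau>" "card S = n"
    "\<And>e. e \<in> carrier (Zp p) \<Longrightarrow>
      \<lfloor>real n / real p\<rfloor> \<le> int (card (sign_part S e)) \<and>
      int (card (sign_part S e)) \<le> \<lceil>real n / real p\<rceil>"
proof -
  define q r where "q = n div p" and "r = n mod p"
  have n_eq: "n = p * q + r"
    by (simp add: q_def r_def)
  have r_less: "r < p"
    using p by (simp add: r_def)
  define D where "D = {e \<in> carrier (Zp p). q < card (sign_part \<tau> e)}"
  have q_le: "q \<le> min_count p \<tau>"
  proof (rule ccontr)
    assume "\<not> q \<le> min_count p \<tau>"
    then have "p * (min_count p \<tau> + 1) \<le> p * q"
      by (intro mult_le_mono2) simp
    then show False
      using n card_excess_less[OF p, of \<tau>] by (simp add: n_eq level_def)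
  qed
  have "r \<le> card D"
  proof (cases "q = min_count p \<tau>")
    case True
    then have "D = excess p \<tau>"
      by (simp add: D_def excess_def)
    then show ?thesis
      using n True by (simp add: n_eq level_def)
  next
    case False
    then have "q < card (sign_part \<tau> e)" if "e \<in> carrier (Zp p)" for e
      using q_le min_count_le[OF p that, of \<tau>] by linarith
    then have "D = carrier (Zp p)"
      by (auto simp: D_def)
    then show ?thesis
      using r_less card_Zp[OF p] by simp
  qed
  then obtain B where B: "B \<subseteq> D" "card B = r"
    by (meson obtain_subset_with_card_n)
  define c where "c e = q + (if e \<in> B then 1 else 0)" for e
  have "\<exists>T. T \<subseteq> sign_part \<tau> e \<and> card T = c e" if e: "e \<in> carrier (Zp p)" for e
  proof -
    have "c e \<le> card (sign_part \<tau> e)"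
      using B(1) q_le min_count_le[OF p e, of \<tau>] by (auto simp: c_def D_def)
    then show ?thesis
      by (meson obtain_subset_with_card_n)
  qed
  then obtain T where T: "\<And>e. e \<in> carrier (Zp p) \<Longrightarrow> T e \<subseteq> sign_part \<tau> e \<and> card (T e) = c e"
    by metis
  define S where "S = (\<Union>e\<in>carrier (Zp p). T e)"
  have fst_T: "fst x = e" if "e \<in> carrier (Zp p)" "x \<in> T e" for e x
    using T[OF that(1)] that(2) by (auto simp: sign_part_def)
  have S_part: "sign_part S e = T e" if e: "e \<in> carrier (Zp p)" for e
  proof (intro equalityI subsetI)
    fix x assume x: "x \<in> sign_part S e"
    then obtain e' where "e' \<in> carrier (Zp p)" "x \<in> T e'"
      by (auto simp: sign_part_def S_def)
    moreover from this have "e' = e"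
      using fst_T x by (force simp: sign_part_def)
    ultimately show "x \<in> T e"
      by simp
  next
    fix x assume "x \<in> T e"
    then show "x \<in> sign_part S e"
      using e fst_T[OF e] by (force simp: sign_part_def S_def)
  qed
  have "S \<subseteq> \<tau>"
    using T by (force simp: S_def sign_part_def)
  moreover have "card S = n"
  proof -
    have "card S = (\<Sum>e\<in>carrier (Zp p). card (T e))"
      unfolding S_def
    proof (rule card_UN_disjoint[OF finite_Zp[OF p]])
      show "\<forall>e\<in>carrier (Zp p). finite (T e)"
        using T finite_sign_part[OF fin] finite_subset by metis
      show "\<forall>e\<in>carrier (Zp p). \<forall>e'\<in>carrier (Zp p). e \<noteq> e' \<longrightarrow> T e \<inter> T e' = {}"
        using fst_T by blast
    qed
    also have "\<dots> = (\<Sum>e\<in>carrier (Zp p). q + (if e \<in> B then 1 else 0))"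
      using T by (intro sum.cong) (auto simp: c_def)
    also have "\<dots> = p * q + card (carrier (Zp p) \<inter> B)"
      using finite_Zp[OF p] by (simp add: sum.distrib card_Zp[OF p] flip: sum.inter_restrict)
    also have "carrier (Zp p) \<inter> B = B"
      using B(1) by (auto simp: D_def)
    finally show ?thesis
      using B(2) n_eq by simp
  qed
  moreover have "\<lfloor>real n / real p\<rfloor> \<le> int (card (sign_part S e)) \<and>
      int (card (sign_part S e)) \<le> \<lceil>real n / real p\<rceil>" if e: "e \<in> carrier (Zp p)" for e
  proof -
    have card: "card (sign_part S e) = c e"
      using S_part[OF e] T[OF e] by simp
    have fl: "\<lfloor>real n / real p\<rfloor> = int q"
      unfolding q_def by (rule floor_divide_of_nat_eq)
    have "int q + 1 \<le> \<lceil>real n / real p\<rceil>" if "e \<in> B"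
    proof -
      have "r > 0"
        using that B finite_subset[of B] finite_Zp[OF p] by (auto simp: card_gt_0_iff D_def)
      then have "real q < real n / real p"
        using p by (simp add: n_eq field_simps flip: of_nat_mult of_nat_add)
      then have "int q < \<lceil>real n / real p\<rceil>"
        by (simp add: less_ceiling_iff)
      then show ?thesis by simp
    qed
    moreover have "int q \<le> \<lceil>real n / real p\<rceil>"
      using fl by (metis floor_le_ceiling)
    ultimately show ?thesis
      using fl by (simp add: card c_def)
  qed
  ultimately show ?thesis
    using that by blast
qed

section \<open>The joins as complexes with an action\<close>

lemma free_simplicial_action_of_free_Zp_complex:
  assumes "p > 0" "free_Zp_complex p K \<phi>"
  shows "free_simplicial_action (Zp p) K \<phi>"
proof -
  have K: "abstract_complex K" "group_action (Zp p) (vertex_set K) \<phi>"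
      "\<And>g. g \<in> carrier (Zp p) \<Longrightarrow> simplicial_map K K (\<phi> g)"
      "\<And>g \<sigma>. g \<in> carrier (Zp p) \<Longrightarrow> g \<noteq> \<one>\<^bsub>Zp p\<^esub> \<Longrightarrow> \<sigma> \<in> K \<Longrightarrow> \<phi> g ` \<sigma> \<noteq> \<sigma>"
    using assms(2) unfolding free_Zp_complex_def simplicial_Zp_complex_def by blast+
  show ?thesis
  proof (intro free_simplicial_action.intro simplicial_action.intro simplicial_action_axioms.intro
      free_simplicial_action_axioms.intro)
    show "g = \<one>\<^bsub>Zp p\<^esub>" if "g \<in> carrier (Zp p)" "\<sigma> \<in> K" "\<phi> g ` \<sigma> = \<sigma>" for g \<sigma>
      using K(4) that by blast
  next
    show "finite (carrier (Zp p))"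
      by (rule finite_Zp[OF assms(1)])
  qed (fact K)+
qed

lemma join_action_eq: "x \<in> carrier (Zp p) \<times> {1..m} \<Longrightarrow> join_action p m g x = translate p g x"
  by (auto simp: join_action_def translate_def)

lemma join_action_image: "\<tau> \<subseteq> carrier (Zp p) \<times> {1..m} \<Longrightarrow> join_action p m g ` \<tau> = translate p g ` \<tau>"
  by (rule image_cong[OF refl join_action_eq]) blast

lemma join_action_in:
  "p > 0 \<Longrightarrow> x \<in> carrier (Zp p) \<times> {1..m} \<Longrightarrow> join_action p m g x \<in> carrier (Zp p) \<times> {1..m}"
  by (auto simp: join_action_eq translate_def mod_in_Zp)

lemma group_action_join:
  assumes p: "p > 0"
  shows "group_action (Zp p) (carrier (Zp p) \<times> {1..m}) (join_action p m)"
proof -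
  let ?V = "carrier (Zp p) \<times> {1..m}"
  have fin: "finite ?V"
    using finite_Zp[OF p] by simp
  have bij: "join_action p m g \<in> Bij ?V" for g
  proof -
    have "inj_on (join_action p m g) ?V"
      using inj_on_translate[OF p, of ?V g] by (auto simp: inj_on_def join_action_eq)
    moreover have "join_action p m g ` ?V \<subseteq> ?V"
      by (rule image_subsetI) (rule join_action_in[OF p])
    ultimately have "bij_betw (join_action p m g) ?V ?V"
      unfolding bij_betw_def using endo_inj_surj[OF fin] by blast
    then show ?thesis
      by (simp add: Bij_def join_action_def)
  qed
  have mult: "join_action p m (g \<otimes>\<^bsub>Zp p\<^esub> h) = compose ?V (join_action p m g) (join_action p m h)" for g h
  proof
    fix x
    show "join_action p m (g \<otimes>\<^bsub>Zp p\<^esub> h) x = compose ?V (join_action p m g) (join_action p m h) x"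
    proof (cases "x \<in> ?V")
      case True
      note hx = join_action_in[OF p True, of h]
      have "join_action p m (g \<otimes>\<^bsub>Zp p\<^esub> h) x = translate p g (translate p h x)"
        unfolding join_action_eq[OF True] by (rule translate_mult[OF p])
      also have "\<dots> = translate p g (join_action p m h x)"
        by (simp only: join_action_eq[OF True])
      also have "\<dots> = join_action p m g (join_action p m h x)"
        by (simp only: join_action_eq[OF hx])
      finally show ?thesis
        unfolding compose_eq[OF True] .
    next
      case False
      then show ?thesis
        unfolding join_action_def compose_def by (simp only: restrict_def if_False)
    qed
  qed
  show ?thesis
    unfolding group_action_def group_hom_def group_hom_axioms_def
  proof (intro conjI)
    show "group (Zp p)"
      by simp
    show "group (BijGroup (carrier (Zp p) \<times> {1..m}))"
      by (rule group_BijGroup)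
    show "join_action p m \<in> hom (Zp p) (BijGroup (carrier (Zp p) \<times> {1..m}))"
      using bij mult by (auto simp: hom_def BijGroup_def simp del: mult_integer_mod_group)
  qed
qed

text \<open>The \<open>t\<close>-fold join of the discrete group with itself: a simplex has at most one vertex in each
  layer.\<close>

definition group_join :: "nat \<Rightarrow> nat \<Rightarrow> (int \<times> nat) set set" where
  "group_join p t = {\<tau>. \<tau> \<noteq> {} \<and> \<tau> \<subseteq> carrier (Zp p) \<times> {1..t} \<and> inj_on snd \<tau>}"

lemma vertex_set_group_join: "vertex_set (group_join p t) = carrier (Zp p) \<times> {1..t}"
proof
  show "vertex_set (group_join p t) \<subseteq> carrier (Zp p) \<times> {1..t}"
    unfolding vertex_set_def group_join_def by blast
  show "carrier (Zp p) \<times> {1..t} \<subseteq> vertex_set (group_join p t)"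
  proof
    fix x assume "x \<in> carrier (Zp p) \<times> {1..t}"
    then have "{x} \<in> group_join p t"
      unfolding group_join_def by (simp del: mem_Sigma_iff)
    then show "x \<in> vertex_set (group_join p t)"
      unfolding vertex_set_def by blast
  qed
qed

lemma free_simplicial_action_group_join:
  assumes p: "p > 0"
  shows "free_simplicial_action (Zp p) (group_join p t) (join_action p t)"
proof (intro free_simplicial_action.intro simplicial_action.intro simplicial_action_axioms.intro
    free_simplicial_action_axioms.intro)
  let ?V = "carrier (Zp p) \<times> {1..t}"
  have fin: "finite ?V"
    using finite_Zp[OF p] by simp
  show "group_action (Zp p) (vertex_set (group_join p t)) (join_action p t)"
    unfolding vertex_set_group_join by (rule group_action_join[OF p])
  show "finite (carrier (Zp p))"
    by (rule finite_Zp[OF p])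
  show "abstract_complex (group_join p t)"
    unfolding abstract_complex_def
  proof (intro conjI ballI allI impI)
    show "finite (group_join p t)"
      by (rule finite_subset[of _ "Pow ?V"]) (use fin in \<open>auto simp: group_join_def\<close>)
    show "finite \<sigma>" if "\<sigma> \<in> group_join p t" for \<sigma>
      using that fin unfolding group_join_def by (blast intro: finite_subset)
    show "\<sigma> \<noteq> {}" if "\<sigma> \<in> group_join p t" for \<sigma>
      using that unfolding group_join_def by blast
    show "\<tau> \<in> group_join p t" if "\<sigma> \<in> group_join p t" "\<tau> \<noteq> {} \<and> \<tau> \<subseteq> \<sigma>" for \<sigma> \<tau>
      using that unfolding group_join_def by (blast intro: inj_on_subset)
  qed
  show "simplicial_map (group_join p t) (group_join p t) (join_action p t g)" for g
    unfolding simplicial_map_def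
  proof
    fix \<tau> assume \<tau>: "\<tau> \<in> group_join p t"
    then have sub: "\<tau> \<subseteq> ?V" and inj: "inj_on snd \<tau>" and "\<tau> \<noteq> {}"
      by (auto simp: group_join_def)
    have "snd (join_action p t g x) = snd x" if "x \<in> \<tau>" for x
      using that sub by (subst join_action_eq) (auto simp: translate_def split: prod.splits)
    then have "inj_on snd (join_action p t g ` \<tau>)"
      using inj by (auto simp: inj_on_def)
    moreover have "join_action p t g ` \<tau> \<subseteq> ?V"
      using sub by (intro image_subsetI join_action_in[OF p]) blast
    ultimately show "join_action p t g ` \<tau> \<in> group_join p t"
      using \<open>\<tau> \<noteq> {}\<close> by (simp add: group_join_def)
  qed
  show "g = \<one>\<^bsub>Zp p\<^esub>" if g: "g \<in> carrier (Zp p)" and \<tau>: "\<tau> \<in> group_join p t"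
    and fixed: "join_action p t g ` \<tau> = \<tau>" for g \<tau>
  proof -
    have sub: "\<tau> \<subseteq> ?V" and inj: "inj_on snd \<tau>" and "\<tau> \<noteq> {}"
      using \<tau> by (auto simp: group_join_def)
    then obtain e j where e: "(e, j) \<in> \<tau>" by auto
    then have "join_action p t g (e, j) \<in> \<tau>"
      using fixed by blast
    moreover have "join_action p t g (e, j) = ((g + e) mod int p, j)"
      using sub e by (subst join_action_eq) (auto simp: translate_def)
    ultimately have "(g + e) mod int p = e"
      using inj_onD[OF inj, of "((g + e) mod int p, j)" "(e, j)"] e by simp
    moreover have eZ: "e \<in> carrier (Zp p)"
      using sub e by blast
    ultimately have "(e + g) mod int p = (e + 0) mod int p"
      by (simp add: add.commute Zp_mem_iff[OF p])
    then have "g = 0"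
      by (rule add_mod_cancel[OF p g integer_mod_group_0])
    then show ?thesis
      by simp
  qed
qed

lemma card_group_join_le:
  assumes "\<tau> \<in> group_join p t" shows "card \<tau> \<le> t"
proof -
  have "card \<tau> = card (snd ` \<tau>)"
    using assms by (simp add: group_join_def card_image)
  also have "\<dots> \<le> card {1..t}"
    using assms by (intro card_mono) (auto simp: group_join_def)
  finally show ?thesis by simp
qed

section \<open>The index bound and the balanced simplex\<close>

text \<open>
  A simplex \<open>\<sigma>\<close> goes to the vertex of the join whose layer is the level of \<open>l ` \<sigma>\<close> and whose
  group element is the sign chosen for the pattern of \<open>l ` \<sigma>\<close>. In a chain, equal levels force
  equal patterns and hence equal signs, so a chain meets each layer at most once.
\<close>

lemma equivariant_map_to_group_join:
  assumes p: "prime p" and C: "free_Zp_complex p C \<phi>"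
    and l: "simplicial_Zp_map p C \<phi> (join_power (sigma_complex p) m) (join_action p m) l"
    and low: "\<And>\<sigma>. \<sigma> \<in> C \<Longrightarrow> level p (l ` \<sigma>) \<le> t"
  obtains f where "continuous_map (realization C) (realization (group_join p t)) f"
    "\<And>g x. g \<in> carrier (Zp p) \<Longrightarrow> x \<in> topspace (realization C) \<Longrightarrow>
      f (realization_map C (\<phi> g) x) = realization_map (group_join p t) (join_action p t g) (f x)"
proof -
  have p0: "p > 0"
    using p prime_gt_0_nat by blast
  interpret C: free_simplicial_action "Zp p" C \<phi>
    using free_simplicial_action_of_free_Zp_complex[OF p0 C] .
  interpret J: free_simplicial_action "Zp p" "group_join p t" "join_action p t"
    using free_simplicial_action_group_join[OF p0] .
  have l_simplex: "l ` \<sigma> \<in> join_power (sigma_complex p) m" if "\<sigma> \<in> C" for \<sigma>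
    using l that unfolding simplicial_Zp_map_def simplicial_map_def by blast
  note l_props = join_power_sigma_D[OF p0 l_simplex]
  have l_sub: "l ` \<sigma> \<subseteq> carrier (Zp p) \<times> UNIV" if "\<sigma> \<in> C" for \<sigma>
    using order_trans[OF l_props(2)[OF that] Sigma_mono[OF order_refl subset_UNIV]] .
  have l_act: "l ` \<phi> g ` \<sigma> = translate p g ` l ` \<sigma>" if "g \<in> carrier (Zp p)" "\<sigma> \<in> C" for g \<sigma>
  proof -
    have "l (\<phi> g v) = join_action p m g (l v)" if "v \<in> \<sigma>" for v
      using l \<open>g \<in> carrier (Zp p)\<close> subsetD[OF C.simplex_subset[OF \<open>\<sigma> \<in> C\<close>] that]
      unfolding simplicial_Zp_map_def by blast
    then have "l ` \<phi> g ` \<sigma> = join_action p m g ` l ` \<sigma>"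
      unfolding image_image by (rule image_cong[OF refl])
    also have "\<dots> = translate p g ` l ` \<sigma>"
      by (rule join_action_image[OF l_props(2)[OF that(2)]])
    finally show ?thesis .
  qed
  obtain s where s_in: "\<And>\<kappa>. \<kappa> \<subseteq> carrier (Zp p) \<times> UNIV \<Longrightarrow> proper_column p \<kappa> \<Longrightarrow> s \<kappa> \<in> carrier (Zp p)"
    and s_translate: "\<And>g \<kappa>. g \<in> carrier (Zp p) \<Longrightarrow> \<kappa> \<subseteq> carrier (Zp p) \<times> UNIV \<Longrightarrow> proper_column p \<kappa> \<Longrightarrow>
      s (translate p g ` \<kappa>) = g \<otimes>\<^bsub>Zp p\<^esub> s \<kappa>"
    using equivariant_sign[OF p] by blast
  note pattern = proper_column_pattern[OF p0 l_simplex]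
  define \<Gamma> where "\<Gamma> \<sigma> = (s (pattern p (l ` \<sigma>)), level p (l ` \<sigma>))" for \<sigma>
  have \<Gamma>_in: "\<Gamma> \<sigma> \<in> carrier (Zp p) \<times> {1..t}" if "\<sigma> \<in> C" for \<sigma>
    using s_in[OF pattern(2,1)] low level_pos[OF p0 l_props(3,1) l_sub] that
    by (auto simp: \<Gamma>_def Suc_le_eq)
  show ?thesis
  proof (rule C.equivariant_map_of_barycentric_map[OF J.simplicial_action_axioms, of \<Gamma>])
    fix S assume S: "S \<subseteq> C" "S \<noteq> {}"
      and chain: "\<And>\<sigma> \<tau>. \<sigma> \<in> S \<Longrightarrow> \<tau> \<in> S \<Longrightarrow> \<sigma> \<subseteq> \<tau> \<or> \<tau> \<subseteq> \<sigma>"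
    have eq: "\<Gamma> \<sigma> = \<Gamma> \<tau>" if "\<sigma> \<in> C" "\<tau> \<in> C" "\<sigma> \<subseteq> \<tau>" "snd (\<Gamma> \<sigma>) = snd (\<Gamma> \<tau>)" for \<sigma> \<tau>
    proof -
      have "level p (l ` \<sigma>) = level p (l ` \<tau>)"
        using that(4) by (simp add: \<Gamma>_def)
      then have "pattern p (l ` \<sigma>) = pattern p (l ` \<tau>)"
        using pattern_eq_of_level_eq[OF p0 l_props(3)[OF that(2)] image_mono[OF that(3)] l_sub[OF that(2)]]
        by blast
      with \<open>level p (l ` \<sigma>) = level p (l ` \<tau>)\<close> show ?thesis
        by (simp add: \<Gamma>_def)
    qed
    have "inj_on snd (\<Gamma> ` S)"
    proof (rule inj_onI)
      fix x y assume "x \<in> \<Gamma> ` S" "y \<in> \<Gamma> ` S" and snd: "snd x = snd y"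
      then obtain \<sigma> \<tau> where st: "\<sigma> \<in> S" "\<tau> \<in> S" "x = \<Gamma> \<sigma>" "y = \<Gamma> \<tau>"
        by blast
      moreover have "\<sigma> \<in> C" "\<tau> \<in> C"
        using st S by blast+
      ultimately show "x = y"
        using chain[OF st(1,2)] eq[of \<sigma> \<tau>] eq[of \<tau> \<sigma>] snd by metis
    qed
    then show "\<Gamma> ` S \<in> group_join p t"
      unfolding group_join_def using S \<Gamma>_in by blast
  next
    fix g \<sigma> assume g: "g \<in> carrier (Zp p)" and \<sigma>: "\<sigma> \<in> C"
    have "\<Gamma> (\<phi> g ` \<sigma>) = (g \<otimes>\<^bsub>Zp p\<^esub> s (pattern p (l ` \<sigma>)), level p (l ` \<sigma>))"
      unfolding \<Gamma>_def l_act[OF g \<sigma>] pattern_translate[OF p0 l_sub[OF \<sigma>]] level_translate[OF p0 l_sub[OF \<sigma>]]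
        s_translate[OF g pattern(2,1)[OF \<sigma>]] ..
    also have "\<dots> = join_action p t g (\<Gamma> \<sigma>)"
      unfolding join_action_eq[OF \<Gamma>_in[OF \<sigma>]] by (simp add: \<Gamma>_def translate_def)
    finally show "\<Gamma> (\<phi> g ` \<sigma>) = join_action p t g (\<Gamma> \<sigma>)" .
  qed (rule that)
qed

lemma realization_empty_iff:
  assumes "abstract_complex K"
  shows "topspace (realization K) = {} \<longleftrightarrow> K = {}"
proof
  assume empty: "topspace (realization K) = {}"
  show "K = {}"
  proof (rule ccontr)
    assume "K \<noteq> {}"
    then obtain \<sigma> where \<sigma>: "\<sigma> \<in> K" by blast
    then have "\<sigma> \<noteq> {}"
      using assms unfolding abstract_complex_def by blast
    then obtain v where v: "v \<in> \<sigma>" by blast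
    have "{v} \<in> K"
      using assms \<sigma> v unfolding abstract_complex_def by blast
    moreover have "finite (vertex_set K)"
      using assms unfolding abstract_complex_def vertex_set_def by blast
    moreover have "v \<in> vertex_set K"
      using \<sigma> v unfolding vertex_set_def by blast
    ultimately have "(\<lambda>u. if u = v then 1 else 0) \<in> topspace (realization K)"
      by (simp add: realization_def)
    with empty show False by simp
  qed
qed (simp add: realization_def)

theorem lemma2:
  fixes p m t :: nat
    and E :: "nat \<Rightarrow> 'e set set" and \<eta> :: "nat \<Rightarrow> int \<Rightarrow> 'e \<Rightarrow> 'e"
    and C :: "'a set set" and \<phi> :: "int \<Rightarrow> 'a \<Rightarrow> 'a"
    and l :: "'a \<Rightarrow> int \<times> nat"
  assumes "prime p" and "m > 0"
    and "\<And>n. is_EnZp p n (E n) (\<eta> n)"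
    and "free_Zp_complex p C \<phi>"
    and "Zp_index_complex p E \<eta> C \<phi> \<ge> ereal (real t)"
    and "simplicial_Zp_map p C \<phi> (join_power (sigma_complex p) m) (join_action p m) l"
  shows "\<exists>\<sigma>\<in>C. simplex_dim \<sigma> = t \<and>
           l ` \<sigma> \<in> join_power (sigma_complex p) m \<and> simplex_dim (l ` \<sigma>) = t \<and>
           (\<forall>\<epsilon>\<in>carrier (Zp p).
              \<lfloor>real (t + 1) / real p\<rfloor> \<le> int (card (sign_part (l ` \<sigma>) \<epsilon>)) \<and>
              int (card (sign_part (l ` \<sigma>) \<epsilon>)) \<le> \<lceil>real (t + 1) / real p\<rceil>)"
proof -
  have p0: "p > 0"
    using assms(1) prime_gt_0_nat by blast
  interpret C: free_simplicial_action "Zp p" C \<phi>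
    using free_simplicial_action_of_free_Zp_complex[OF p0 assms(4)] .
  have l_simplex: "l ` \<sigma> \<in> join_power (sigma_complex p) m" if "\<sigma> \<in> C" for \<sigma>
    using assms(6) that unfolding simplicial_Zp_map_def simplicial_map_def by blast
  note \<tau>D = join_power_sigma_D[OF p0 l_simplex]
  have l_sub: "l ` \<sigma> \<subseteq> carrier (Zp p) \<times> UNIV" if "\<sigma> \<in> C" for \<sigma>
    using order_trans[OF \<tau>D(2)[OF that] Sigma_mono[OF order_refl subset_UNIV]] .
  have nonempty: "topspace (realization C) \<noteq> {}"
  proof
    assume "topspace (realization C) = {}"
    then have "Zp_index_complex p E \<eta> C \<phi> = -1"
      by (simp add: Zp_index_complex_def Zp_index_def)
    then have "ereal (real t) \<le> ereal (-1)"
      using assms(5) by (simp add: one_ereal_def)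
    then show False
      by simp
  qed
  have "\<exists>\<sigma>\<in>C. t < level p (l ` \<sigma>)"
  proof (rule ccontr)
    assume "\<not> (\<exists>\<sigma>\<in>C. t < level p (l ` \<sigma>))"
    then have low: "\<And>\<sigma>. \<sigma> \<in> C \<Longrightarrow> level p (l ` \<sigma>) \<le> t"
      by force
    obtain \<sigma> where "\<sigma> \<in> C"
      using nonempty realization_empty_iff[OF C.complex] by blast
    then have "0 < level p (l ` \<sigma>)"
      using \<tau>D(3,1) l_sub by (intro level_pos[OF p0])
    \<comment> \<open>Levels are positive, so \<open>t\<close> is too, and \<open>group_join p t\<close> has dimension \<open>n = t - 1\<close>.\<close>
    then obtain n where n: "t = Suc n"
      using low[OF \<open>\<sigma> \<in> C\<close>] by (cases t) auto
    interpret J: free_simplicial_action "Zp p" "group_join p t" "join_action p t"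
      using free_simplicial_action_group_join[OF p0] .
    have E: "free_Zp_complex p (E n) (\<eta> n)" "connected_upto (int n - 1) (realization (E n))"
      using assms(3)[of n] unfolding is_EnZp_def by blast+
    interpret E: free_simplicial_action "Zp p" "E n" "\<eta> n"
      using free_simplicial_action_of_free_Zp_complex[OF p0 E(1)] .
    obtain F where F: "continuous_map (realization (group_join p t)) (realization (E n)) F"
      "\<And>g x. g \<in> carrier (Zp p) \<Longrightarrow> x \<in> J.points \<Longrightarrow> F (J.act g x) = E.act g (F x)"
      using J.equivariant_map_to_connected_space[OF E.topological_action_realization E(2)]
        card_group_join_le[of _ p t] unfolding n by blast
    obtain f where f: "continuous_map (realization C) (realization (group_join p t)) f"
      "\<And>g x. g \<in> carrier (Zp p) \<Longrightarrow> x \<in> C.points \<Longrightarrow> f (C.act g x) = J.act g (f x)"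
      using equivariant_map_to_group_join[OF assms(1,4,6) low] by blast
    have "f x \<in> J.points" if "x \<in> C.points" for x
      using continuous_map_image_subset_topspace[OF f(1)] that by blast
    then have "equivariant_map p (realization C) C.act (realization (E n)) E.act (F \<circ> f)"
      unfolding equivariant_map_def using continuous_map_compose[OF f(1) F(1)] f(2) F(2) by simp
    then have "Zp_index_complex p E \<eta> C \<phi> \<le> ereal (real n)"
      unfolding Zp_index_complex_def Zp_index_def using nonempty by (auto intro!: Inf_lower)
    then have "ereal (real t) \<le> ereal (real n)"
      using assms(5) by (rule order_trans[rotated])
    then show False
      by (simp add: n)
  qed
  then obtain \<sigma> where \<sigma>: "\<sigma> \<in> C" and level: "t + 1 \<le> level p (l ` \<sigma>)"
    by auto
  from balanced_subset_of_level[OF p0 \<tau>D(3) l_sub level, OF \<sigma> \<sigma>]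
  obtain S where S: "S \<subseteq> l ` \<sigma>" "card S = t + 1"
    and balanced: "\<And>e. e \<in> carrier (Zp p) \<Longrightarrow>
      \<lfloor>real (t + 1) / real p\<rfloor> \<le> int (card (sign_part S e)) \<and>
      int (card (sign_part S e)) \<le> \<lceil>real (t + 1) / real p\<rceil>"
    by blast
  \<comment> \<open>A face of \<open>\<sigma>\<close> that \<open>l\<close> maps bijectively to the balanced set \<open>S\<close>.\<close>
  obtain \<sigma>' where \<sigma>': "\<sigma>' \<subseteq> \<sigma>" "inj_on l \<sigma>'" "S = l ` \<sigma>'"
    using S(1) unfolding subset_image_inj by blast
  have "card \<sigma>' = t + 1"
    using S(2) \<sigma>' by (simp add: card_image)
  then have "\<sigma>' \<in> C"
    using C.face_closed[OF \<sigma> \<sigma>'(1)] by fastforce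
  then show ?thesis
    using S(2) \<open>card \<sigma>' = t + 1\<close> balanced l_simplex unfolding \<sigma>'(3) simplex_dim_def
    by (intro bexI[of _ \<sigma>']) auto
qed

end
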